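(* Let $p>1$, $d\geq 1$, let $u\in C_c^2(\mathbb{R}^d\setminus\{0\})$ be odd, and let $\gamma\in\mathbb{R}$ be such that $$ N:=(\gamma+2p-2)\left(4(p-1)+p(d-\gamma-2p)\right)+(p-1)(d-\gamma-2p+2)^2\geq 0 . $$ Then $$ \int_{\mathbb{R}^d}\frac{|\Delta u(x)|^p}{|x|^{\gamma}}\,dx\geq D_R(d,p,\gamma)\int_{\mathbb{R}^d}\frac{|u(x)|^p}{|x|^{\gamma+2p}}\,dx, \qquad\text{where}\qquad D_R(d,p,\gamma)=\left(\frac{N}{p^2}\right)^p. $$
   Context: A function $u$ is odd if $u(-x)=-u(x)$. $C^2_c(\mathbb{R}^d\setminus\{0\})$ is the space of $C^2$ functions with compact support contained in $\mathbb{R}^d\setminus\{0\}$. $\Delta$ is the Laplacian and $|\cdot|$ the Euclidean norm. *)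

theory Defs
  imports "HOL-Analysis.Analysis"
begin

definition C1_on :: "'a::euclidean_space set \<Rightarrow> ('a \<Rightarrow> real) \<Rightarrow> bool" where
  "C1_on S f \<longleftrightarrow> open S \<and> (\<forall>x\<in>S. f differentiable at x) \<and>
     (\<forall>v. continuous_on S (\<lambda>x. frechet_derivative f (at x) v))"

definition C2_on :: "'a::euclidean_space set \<Rightarrow> ('a \<Rightarrow> real) \<Rightarrow> bool" where
  "C2_on S f \<longleftrightarrow> C1_on S f \<and> (\<forall>v. C1_on S (\<lambda>x. frechet_derivative f (at x) v))"

text \<open>Elements of \<open>C\<^sup>2\<^sub>c(S)\<close> are regarded as functions on the whole space that vanish
  outside \<open>S\<close>. The closure is taken in the whole space, so for \<open>S = - {0}\<close> the function
  vanishes near the origin.\<close>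

definition C2c :: "'a::euclidean_space set \<Rightarrow> ('a \<Rightarrow> real) set" where
  "C2c S = {f. C2_on S f \<and> compact (closure (support_on UNIV f)) \<and>
     closure (support_on UNIV f) \<subseteq> S}"

definition odd_fun :: "('a::real_vector \<Rightarrow> real) \<Rightarrow> bool" where
  "odd_fun f \<longleftrightarrow> (\<forall>x. f (- x) = - f x)"

definition laplacian :: "('a::euclidean_space \<Rightarrow> real) \<Rightarrow> 'a \<Rightarrow> real" where
  "laplacian f x =
     (\<Sum>b\<in>Basis. frechet_derivative (\<lambda>y. frechet_derivative f (at y) b) (at x) b)"

definition rellich_N :: "nat \<Rightarrow> real \<Rightarrow> real \<Rightarrow> real" where
  "rellich_N d p \<gamma> =
     (\<gamma> + 2 * p - 2) * (4 * (p - 1) + p * (real d - \<gamma> - 2 * p))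
     + (p - 1) * (real d - \<gamma> - 2 * p + 2)\<^sup>2"

definition D_R :: "nat \<Rightarrow> real \<Rightarrow> real \<Rightarrow> real" where
  "D_R d p \<gamma> = (rellich_N d p \<gamma> / p\<^sup>2) powr p"

end

theory Submission
  imports Defs
begin

text \<open>Write \<open>d\<close> for the dimension and \<open>\<alpha> = \<gamma> + 2 * p - 2\<close>. Multiply \<open>- \<Delta> u\<close> by
\<open>\<bar>u\<bar>\<^sup>p\<^sup>-\<^sup>2 u \<bar>x\<bar> powr (- \<alpha>)\<close> and integrate by parts twice. With \<open>v = \<bar>u\<bar> powr (p / 2 - 1) * u\<close> this
leaves the energy \<open>4 (p - 1) / p\<^sup>2 \<integral> \<bar>\<nabla>v\<bar>\<^sup>2 \<bar>x\<bar> powr (- \<alpha>)\<close> plus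
\<open>\<alpha> (d - 2 - \<alpha>) / p \<integral> \<bar>u\<bar>\<^sup>p \<bar>x\<bar> powr (- \<alpha> - 2)\<close>. The weighted Hardy inequality bounds the energy from
below by a multiple of \<open>\<integral> v\<^sup>2 \<bar>x\<bar> powr (- \<alpha> - 2) = \<integral> \<bar>u\<bar>\<^sup>p \<bar>x\<bar> powr (- \<alpha> - 2)\<close>; since \<open>v\<close> is odd, the usual
Hardy constant \<open>((d - 2 - \<alpha>) / 2)\<^sup>2\<close> improves by \<open>d - 1\<close> (lemma \<open>odd_hardy\<close>). The two constants
add up to \<open>B = N / p\<^sup>2\<close>, so that \<open>B \<integral> \<bar>u\<bar>\<^sup>p \<bar>x\<bar> powr (- \<alpha> - 2)\<close> is at most
\<open>\<integral> \<bar>\<Delta>u\<bar> \<bar>u\<bar> powr (p - 1) \<bar>x\<bar> powr (- \<alpha>)\<close> (lemma \<open>odd_rellich_bilinear\<close>). The convex function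
\<open>t powr p\<close> lies above its tangents, and integrating the tangent inequality at the point \<open>B\<close> times the
weighted \<open>\<bar>u\<bar>\<close> turns this bound into the claim; it does the work of Hoelder's inequality.

The gain \<open>d - 1\<close> is the first nonzero eigenvalue of the Laplacian on the sphere. It is obtained
without spherical harmonics. After the substitution \<open>w = \<bar>x\<bar> powr ((d - 2 - \<alpha>) / 2) * v\<close> one needs
\<open>(d - 1) \<integral> w\<^sup>2 \<bar>x\<bar>\<^sup>-\<^sup>d \<le> \<integral> \<bar>\<nabla>w\<bar>\<^sup>2 \<bar>x\<bar>\<^sup>2\<^sup>-\<^sup>d\<close>. An odd function changes sign under a half turn of any great
circle, and for such antiperiodic functions of an angle Wirtinger's inequality \<open>\<integral> f\<^sup>2 \<le> \<integral> f'\<^sup>2\<close> holds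
with constant one. Summing it over the \<open>d - 1\<close> circles that leave a point in the directions of an
orthonormal frame gives the full tangential gradient on the right and \<open>d - 1\<close> copies of \<open>w\<^sup>2\<close> on the left.

To average over all frames one would use Haar measure on the orthogonal group. Here the average runs
instead over the matrices that distort lengths by at most a factor \<open>s > 1\<close>, with Lebesgue measure: this
set is also invariant under right multiplication by orthogonal matrices, great circles become
ellipses, on which odd functions are still antiperiodic, and every distortion is a power of \<open>s\<close>, so
that \<open>s \<rightarrow> 1\<close> gives the sharp constant.

For \<open>p < 2\<close> the function \<open>v\<close> need not be differentiable at the zeros of \<open>u\<close>. The integrations by parts
are therefore carried out with \<open>u\<^sup>2\<close> replaced by \<open>u\<^sup>2 + e\<close> in the powers, chosen such that the relation
between the two energies remains valid as an inequality, and \<open>e \<rightarrow> 0\<close> at the end.\<close>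

section \<open>Wirtinger's inequality for antiperiodic functions\<close>

text \<open>The function has a zero \<open>t0\<close>, and \<open>f'\<^sup>2 - f\<^sup>2 = (f' - f * cot (t - t0))\<^sup>2 + (f\<^sup>2 * cot (t - t0))'\<close>. The function under
the last derivative has period \<open>pi\<close>, so that derivative integrates to zero over \<open>{0..pi}\<close>.\<close>

lemma wirtinger_antiperiodic:
  fixes f f' :: "real \<Rightarrow> real"
  assumes deriv: "\<And>t. (f has_real_derivative f' t) (at t)"
    and cont: "continuous_on UNIV f'"
    and anti: "\<And>t. f (t + pi) = - f t"
  shows "integral {0..pi} (\<lambda>t. (f t)\<^sup>2) \<le> integral {0..pi} (\<lambda>t. (f' t)\<^sup>2)"
proof -
  have contf: "continuous_on A f" for A
    using deriv DERIV_isCont continuous_at_imp_continuous_on by blast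
  have contf': "continuous_on A f'" for A
    using cont continuous_on_subset by blast
  \<comment> \<open>Antiperiodicity makes the values at the two ends opposite.\<close>
  have "\<exists>t0\<ge>0. t0 \<le> pi \<and> f t0 = 0"
  proof (cases "f 0 \<le> 0")
    case True
    then show ?thesis using anti[of 0] IVT'[of f 0 0 pi] contf by auto
  next
    case False
    then show ?thesis using anti[of 0] IVT2'[of f pi 0 0] contf by auto
  qed
  then obtain t0 where t0: "0 \<le> t0" "t0 \<le> pi" "f t0 = 0" by blast
  have anti': "f (t - pi) = - f t" for t using anti[of "t - pi"] by simp
  define q where "q t = (f t)\<^sup>2 * cot (t - t0)" for t
  define q' where "q' t = 2 * f t * f' t * cot (t - t0) - (f t)\<^sup>2 * inverse ((sin (t - t0))\<^sup>2)" for t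
  define Z where "Z = {t \<in> {0..pi}. sin (t - t0) = 0}"
  have Z: "Z \<subseteq> {t0, t0 - pi, t0 + pi}"
  proof
    fix t assume "t \<in> Z"
    then have *: "0 \<le> t" "t \<le> pi" "sin (t - t0) = 0" by (auto simp: Z_def)
    then obtain i :: int where i: "t - t0 = of_int i * pi" unfolding sin_zero_iff_int2 by blast
    have "\<bar>t - t0\<bar> \<le> 1 * pi" using * t0 by auto
    then have "\<bar>of_int i :: real\<bar> * pi \<le> 1 * pi" unfolding i by (simp add: abs_mult)
    then have "\<bar>of_int i :: real\<bar> \<le> 1" using pi_gt_zero mult_le_cancel_right_pos by blast
    then have "\<bar>i\<bar> \<le> 1" by linarith
    then have "i = 0 \<or> i = 1 \<or> i = -1" by linarith
    then show "t \<in> {t0, t0 - pi, t0 + pi}" using i by auto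
  qed
  have "finite Z" using Z finite_subset by blast
  have fZ: "f t = 0" if "t \<in> {t0, t0 - pi, t0 + pi}" for t
    using that anti[of t0] anti'[of t0] t0 by auto
  have qd: "(q has_real_derivative q' t) (at t)" if "sin (t - t0) \<noteq> 0" for t
  proof -
    have "((\<lambda>t. cot (t - t0)) has_real_derivative - inverse ((sin (t - t0))\<^sup>2) * 1) (at t)"
      by (rule DERIV_chain2[where f = cot and g = "\<lambda>t. t - t0", OF DERIV_cot[OF that]]) (auto intro!: derivative_eq_intros)
    from DERIV_mult[OF DERIV_power[OF deriv[of t], of 2] this] show ?thesis
      unfolding q_def[abs_def] q'_def by (simp add: algebra_simps)
  qed
  \<comment> \<open>The poles of \<open>cot (t - t0)\<close> meet double zeros of \<open>f\<^sup>2\<close>, so \<open>q\<close> extends continuously by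
    the value \<open>0\<close>, which is also the value that \<open>cot 0 = 0\<close> gives it.\<close>
  have qc0: "isCont q t" if "sin (t - t0) = 0" "f t = 0" for t
  proof -
    have cs: "cos (t - t0) \<noteq> 0"
      using that(1) sin_cos_squared_add[of "t - t0"] by auto
    have "((\<lambda>s. sin (s - t0)) has_real_derivative cos (t - t0)) (at t)"
      by (auto intro!: derivative_eq_intros)
    then have l1: "((\<lambda>s. sin (s - t0) / (s - t)) \<longlongrightarrow> cos (t - t0)) (at t)"
      using that by (simp add: has_field_derivative_iff)
    have l2: "((\<lambda>s. f s / (s - t)) \<longlongrightarrow> f' t) (at t)"
      using deriv[of t] that by (simp add: has_field_derivative_iff)
    have lf: "(f \<longlongrightarrow> 0) (at t)"
      using DERIV_isCont[OF deriv[of t]] that by (simp add: isCont_def)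
    have lc: "((\<lambda>s. cos (s - t0)) \<longlongrightarrow> cos (t - t0)) (at t)"
      by (intro tendsto_intros)
    have "((\<lambda>s. f s * cos (s - t0) * ((f s / (s - t)) / (sin (s - t0) / (s - t)))) \<longlongrightarrow>
       0 * cos (t - t0) * (f' t / cos (t - t0))) (at t)"
      by (intro tendsto_intros l1 l2 lf lc cs)
    moreover have "eventually (\<lambda>s. f s * cos (s - t0) * ((f s / (s - t)) / (sin (s - t0) / (s - t))) = q s) (at t)"
      unfolding eventually_at_filter
      by (rule always_eventually) (auto simp: q_def cot_def power2_eq_square)
    ultimately have "(q \<longlongrightarrow> 0) (at t)"
      using tendsto_cong by force
    then show ?thesis using that by (simp add: isCont_def q_def)
  qed
  have qc: "continuous_on {0..pi} q"
  proof (intro continuous_at_imp_continuous_on ballI)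
    fix t assume t: "t \<in> {0..pi}"
    show "isCont q t"
    proof (cases "sin (t - t0) = 0")
      case True
      then have "t \<in> Z" using t by (simp add: Z_def)
      then show ?thesis using qc0 True fZ Z by blast
    next
      case False then show ?thesis using qd DERIV_isCont by blast
    qed
  qed
  have "(q' has_integral (q pi - q 0)) {0..pi}"
    using \<open>finite Z\<close> qc qd
    by (intro fundamental_theorem_of_calculus_strong[of Z])
      (auto simp: Z_def has_real_derivative_iff_has_vector_derivative)
  moreover have "q pi = q 0"
  proof -
    have "cot (pi - t0) = cot (0 - t0)" by (simp add: cot_def)
    then show ?thesis using anti[of 0] by (simp add: q_def)
  qed
  ultimately have q'int: "(q' has_integral 0) {0..pi}" by simp
  have i1: "(\<lambda>t. (f t)\<^sup>2) integrable_on {0..pi}"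
    by (intro integrable_continuous_real continuous_intros contf)
  have i2: "(\<lambda>t. (f' t)\<^sup>2) integrable_on {0..pi}"
    by (intro integrable_continuous_real continuous_intros contf')
  have "((\<lambda>t. (f' t)\<^sup>2 - (f t)\<^sup>2) has_integral
      (integral {0..pi} (\<lambda>t. (f' t)\<^sup>2) - integral {0..pi} (\<lambda>t. (f t)\<^sup>2))) {0..pi}"
    by (intro has_integral_diff integrable_integral i1 i2)
  then have "((\<lambda>t. if t \<in> Z then q' t else (f' t)\<^sup>2 - (f t)\<^sup>2) has_integral
      (integral {0..pi} (\<lambda>t. (f' t)\<^sup>2) - integral {0..pi} (\<lambda>t. (f t)\<^sup>2))) {0..pi}"
    by (rule has_integral_spike_finite[OF \<open>finite Z\<close>, rotated]) auto
  with q'int have "0 \<le> integral {0..pi} (\<lambda>t. (f' t)\<^sup>2) - integral {0..pi} (\<lambda>t. (f t)\<^sup>2)"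
  proof (rule has_integral_le)
    fix t assume "t \<in> {0..pi}"
    have "q' t \<le> (f' t)\<^sup>2 - (f t)\<^sup>2" if "t \<notin> Z"
    proof -
      define S C where "S = sin (t - t0)" and "C = cos (t - t0)"
      have S: "S \<noteq> 0" "C\<^sup>2 = 1 - S\<^sup>2"
        using that \<open>t \<in> {0..pi}\<close> by (auto simp: Z_def S_def C_def cos_squared_eq)
      have "0 \<le> (f' t - f t * (C / S))\<^sup>2" by simp
      also have "\<dots> = (f' t)\<^sup>2 - 2 * f t * f' t * (C / S) + (f t)\<^sup>2 * (C\<^sup>2 / S\<^sup>2)"
        by (simp add: power2_diff power_mult_distrib power_divide algebra_simps)
      also have "C\<^sup>2 / S\<^sup>2 = inverse (S\<^sup>2) - 1"
        using S by (simp add: divide_simps)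
      finally show ?thesis
        unfolding q'_def cot_def S_def[symmetric] C_def[symmetric] by (simp add: algebra_simps)
    qed
    then show "q' t \<le> (if t \<in> Z then q' t else (f' t)\<^sup>2 - (f t)\<^sup>2)" by simp
  qed
  then show ?thesis by simp
qed

section \<open>Lebesgue measure under linear maps\<close>

text \<open>Uniqueness of translation invariant measures, in the form that two of them are proportional. Both
sides are equal to the double integral of \<open>f x * g (x + y)\<close>.\<close>

lemma lborel_unique_up_to_factor:
  fixes M :: "'a::euclidean_space measure" and f g :: "'a \<Rightarrow> ennreal"
  assumes [measurable_cong, simp]: "sets M = sets borel" and "sigma_finite_measure M"
    and transl: "\<And>c. distr M borel ((+) c) = M"
    and [measurable]: "f \<in> borel_measurable borel" "g \<in> borel_measurable borel"
  shows "(\<integral>\<^sup>+x. f x \<partial>M) * (\<integral>\<^sup>+x. g x \<partial>lborel) = (\<integral>\<^sup>+x. g x \<partial>M) * (\<integral>\<^sup>+x. f x \<partial>lborel)"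
proof -
  interpret M: sigma_finite_measure M by fact
  interpret P: pair_sigma_finite lborel M ..
  have refl: "(\<integral>\<^sup>+y. f (x - y) \<partial>lborel) = (\<integral>\<^sup>+y. f y \<partial>lborel)" for x
  proof -
    have "(\<integral>\<^sup>+y. f y \<partial>lborel) = (\<integral>\<^sup>+y. f y \<partial>distr lborel borel ((-) x))"
      using lborel_affine[of "-1" x] by (simp add: density_1)
    then show ?thesis by (simp add: nn_integral_distr)
  qed
  have "(\<integral>\<^sup>+x. f x \<partial>M) * (\<integral>\<^sup>+y. g y \<partial>lborel) = (\<integral>\<^sup>+x. (\<integral>\<^sup>+y. f x * g y \<partial>lborel) \<partial>M)"
    by (simp add: nn_integral_cmult nn_integral_multc)
  also have "\<dots> = (\<integral>\<^sup>+x. (\<integral>\<^sup>+y. f x * g (x + y) \<partial>lborel) \<partial>M)"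
  proof (rule nn_integral_cong)
    fix x
    show "(\<integral>\<^sup>+y. f x * g y \<partial>lborel) = (\<integral>\<^sup>+y. f x * g (x + y) \<partial>lborel)"
      by (subst lborel_distr_plus[of x, symmetric]) (simp add: nn_integral_distr)
  qed
  also have "\<dots> = (\<integral>\<^sup>+y. (\<integral>\<^sup>+x. f x * g (x + y) \<partial>M) \<partial>lborel)"
    by (rule P.Fubini') simp
  also have "\<dots> = (\<integral>\<^sup>+y. (\<integral>\<^sup>+x. f (x - y) * g x \<partial>M) \<partial>lborel)"
  proof (rule nn_integral_cong)
    fix y
    show "(\<integral>\<^sup>+x. f x * g (x + y) \<partial>M) = (\<integral>\<^sup>+x. f (x - y) * g x \<partial>M)"
      by (subst transl[of "- y", symmetric]) (simp add: nn_integral_distr)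
  qed
  also have "\<dots> = (\<integral>\<^sup>+x. (\<integral>\<^sup>+y. f (x - y) * g x \<partial>lborel) \<partial>M)"
    by (rule P.Fubini'[symmetric]) simp
  also have "\<dots> = (\<integral>\<^sup>+x. g x \<partial>M) * (\<integral>\<^sup>+x. f x \<partial>lborel)"
    by (simp add: nn_integral_multc refl mult.commute[of "integral\<^sup>N lborel f"])
  finally show ?thesis .
qed

text \<open>The image of Lebesgue measure under a linear bijection is again translation invariant, hence a
multiple of Lebesgue measure. The factor is read off from the unit ball, whose preimage lies between
the balls of radius \<open>1 / s\<close> and \<open>s\<close>.\<close>

lemma nn_integral_near_isometry:
  fixes L :: "'a::euclidean_space \<Rightarrow> 'a" and f :: "'a \<Rightarrow> ennreal"
  assumes "linear L" and "s \<ge> 1"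
    and lower: "\<And>x. norm x \<le> s * norm (L x)" and upper: "\<And>x. norm (L x) \<le> s * norm x"
    and [measurable]: "f \<in> borel_measurable borel"
  shows nn_integral_near_isometry_le:
      "(\<integral>\<^sup>+x. f (L x) \<partial>lborel) \<le> ennreal (s ^ DIM('a)) * (\<integral>\<^sup>+x. f x \<partial>lborel)"
    and nn_integral_near_isometry_ge:
      "(\<integral>\<^sup>+x. f x \<partial>lborel) \<le> ennreal (s ^ DIM('a)) * (\<integral>\<^sup>+x. f (L x) \<partial>lborel)"
proof -
  define M where "M = distr lborel borel L"
  define V where "V = unit_ball_vol (real DIM('a))"
  have V: "V > 0" unfolding V_def by simp
  interpret L: linear L by fact
  have [measurable]: "L \<in> borel_measurable borel"
    using linear_continuous_on[OF L.linear_axioms[unfolded linear_conv_bounded_linear]]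
    by (intro borel_measurable_continuous_onI)
  have "inj L"
  proof (rule injI)
    fix x y assume "L x = L y"
    then have "L (x - y) = 0" by (simp add: L.diff)
    then show "x = y" using lower[of "x - y"] by simp
  qed
  then have "surj L" using linear_injective_imp_surjective[OF L.linear_axioms] by blast
  have [measurable_cong, simp]: "sets M = sets borel" unfolding M_def by simp
  have vim: "emeasure M (ball 0 r) = emeasure lborel (L -` ball 0 r)" for r
    unfolding M_def by (simp add: emeasure_distr)
  have mL [measurable]: "L -` ball 0 r \<in> sets borel" for r
    using measurable_sets[of L borel borel "ball 0 r"] by simp
  have balle: "emeasure lborel (ball (0::'a) r) = ennreal (V * r ^ DIM('a))" if "r \<ge> 0" for r
    using that emeasure_ball[of r 0] by (simp add: V_def)
  have ub: "emeasure M (ball 0 r) \<le> ennreal (V * (s * r) ^ DIM('a))" if "r \<ge> 0" for r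
  proof -
    have "L -` ball 0 r \<subseteq> ball 0 (s * r)"
    proof
      fix x assume "x \<in> L -` ball 0 r"
      then have "norm (L x) < r" by simp
      then have "s * norm (L x) < s * r" using \<open>s \<ge> 1\<close> by simp
      then show "x \<in> ball 0 (s * r)" using lower[of x] by simp
    qed
    then have "emeasure lborel (L -` ball 0 r) \<le> emeasure lborel (ball (0::'a) (s * r))"
      by (intro emeasure_mono) auto
    then show ?thesis using balle[of "s * r"] that \<open>s \<ge> 1\<close> vim by simp
  qed
  have lb: "ennreal (V * (1 / s) ^ DIM('a)) \<le> emeasure M (ball 0 1)"
  proof -
    have "ball 0 (1 / s) \<subseteq> L -` ball 0 1"
    proof
      fix x assume "x \<in> ball (0::'a) (1 / s)"
      then have "s * norm x < 1" using \<open>s \<ge> 1\<close> by (simp add: field_simps)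
      then show "x \<in> L -` ball 0 1" using upper[of x] by simp
    qed
    then have "emeasure lborel (ball (0::'a) (1 / s)) \<le> emeasure lborel (L -` ball 0 1)"
      by (intro emeasure_mono) auto
    then show ?thesis using balle[of "1 / s"] \<open>s \<ge> 1\<close> vim by simp
  qed
  have sf: "sigma_finite_measure M"
  proof
    have "\<exists>n. norm x < real n" for x :: 'a
      using reals_Archimedean2 by blast
    then have "(\<Union>n::nat. ball (0::'a) (real n)) = UNIV" by auto
    moreover have "emeasure M (ball 0 (real n)) \<noteq> \<infinity>" for n
      using le_less_trans[OF ub[of "real n"] ennreal_less_top] by simp
    ultimately show "\<exists>A. countable A \<and> A \<subseteq> sets M \<and> \<Union>A = space M \<and> (\<forall>a\<in>A. emeasure M a \<noteq> \<infinity>)"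
      by (intro exI[of _ "range (\<lambda>n::nat. ball (0::'a) (real n))"] conjI)
        (simp_all add: M_def image_subset_iff)
  qed
  have tr: "distr M borel ((+) c) = M" for c
  proof -
    obtain b where b: "c = L b" using \<open>surj L\<close> by blast
    have "distr M borel ((+) c) = distr lborel borel (L \<circ> (+) b)"
      unfolding M_def by (subst distr_distr) (simp_all add: b L.add o_def)
    also have "\<dots> = distr (distr lborel borel ((+) b)) borel L"
      by (subst distr_distr) simp_all
    finally show ?thesis by (simp add: lborel_distr_plus M_def)
  qed
  have Mf: "(\<integral>\<^sup>+x. f x \<partial>M) = (\<integral>\<^sup>+x. f (L x) \<partial>lborel)"
    unfolding M_def by (simp add: nn_integral_distr)
  have eq: "(\<integral>\<^sup>+x. f (L x) \<partial>lborel) * ennreal V = emeasure M (ball 0 1) * (\<integral>\<^sup>+x. f x \<partial>lborel)"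
    using lborel_unique_up_to_factor[OF _ sf tr, of f "indicator (ball 0 1)"] balle[of 1]
      borel_measurable_indicator[of "ball (0::'a) 1" borel]
    by (simp add: Mf)
  have cancel: "a \<le> b" if "a * ennreal V \<le> b * ennreal V" for a b :: ennreal
    using that V by (simp add: mult.commute[of _ "ennreal V"] ennreal_mult_le_mult_iff)
  show "(\<integral>\<^sup>+x. f (L x) \<partial>lborel) \<le> ennreal (s ^ DIM('a)) * (\<integral>\<^sup>+x. f x \<partial>lborel)"
  proof (rule cancel)
    have "emeasure M (ball 0 1) \<le> ennreal (s ^ DIM('a)) * ennreal V"
      using ub[of 1] V \<open>s \<ge> 1\<close> by (simp add: ennreal_mult[symmetric] mult.commute)
    then have "emeasure M (ball 0 1) * (\<integral>\<^sup>+x. f x \<partial>lborel)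
        \<le> (ennreal (s ^ DIM('a)) * ennreal V) * (\<integral>\<^sup>+x. f x \<partial>lborel)"
      by (rule mult_right_mono) simp
    then show "(\<integral>\<^sup>+x. f (L x) \<partial>lborel) * ennreal V
        \<le> ennreal (s ^ DIM('a)) * (\<integral>\<^sup>+x. f x \<partial>lborel) * ennreal V"
      unfolding eq by (simp add: ac_simps)
  qed
  show "(\<integral>\<^sup>+x. f x \<partial>lborel) \<le> ennreal (s ^ DIM('a)) * (\<integral>\<^sup>+x. f (L x) \<partial>lborel)"
  proof (rule cancel)
    have "ennreal V = ennreal (s ^ DIM('a)) * ennreal (V * (1 / s) ^ DIM('a))"
      using V \<open>s \<ge> 1\<close> by (simp add: ennreal_mult[symmetric] field_simps)
    also have "\<dots> \<le> ennreal (s ^ DIM('a)) * emeasure M (ball 0 1)"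
      by (intro mult_left_mono lb) simp
    finally have "(\<integral>\<^sup>+x. f x \<partial>lborel) * ennreal V
        \<le> (\<integral>\<^sup>+x. f x \<partial>lborel) * (ennreal (s ^ DIM('a)) * emeasure M (ball 0 1))"
      by (intro mult_left_mono) auto
    also have "\<dots> = ennreal (s ^ DIM('a)) * (emeasure M (ball 0 1) * (\<integral>\<^sup>+x. f x \<partial>lborel))"
      by (simp add: ac_simps)
    also have "\<dots> = ennreal (s ^ DIM('a)) * (\<integral>\<^sup>+x. f (L x) \<partial>lborel) * ennreal V"
      unfolding eq[symmetric] by (simp add: ac_simps)
    finally show "(\<integral>\<^sup>+x. f x \<partial>lborel) * ennreal V
        \<le> ennreal (s ^ DIM('a)) * (\<integral>\<^sup>+x. f (L x) \<partial>lborel) * ennreal V" .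
  qed
qed

lemma nn_integral_isometry:
  fixes L :: "'a::euclidean_space \<Rightarrow> 'a" and f :: "'a \<Rightarrow> ennreal"
  assumes "orthogonal_transformation L" and "f \<in> borel_measurable borel"
  shows "(\<integral>\<^sup>+x. f (L x) \<partial>lborel) = (\<integral>\<^sup>+x. f x \<partial>lborel)"
proof -
  have "linear L" "\<And>x. norm (L x) = norm x"
    using assms(1) by (auto simp: orthogonal_transformation)
  then show ?thesis
    using nn_integral_near_isometry_le[of L 1 f] nn_integral_near_isometry_ge[of L 1 f] assms(2)
    by (intro antisym) auto
qed

section \<open>Matrices close to the orthogonal group\<close>

text \<open>A neighbourhood of the orthogonal group that replaces Haar measure: unlike the orthogonal group itself
it has positive Lebesgue measure for \<open>s > 1\<close>, and it shrinks to that group as \<open>s\<close> decreases to one.\<close>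

definition near_isometries :: "real \<Rightarrow> (real^'n^'n) set" where
  "near_isometries s =
     {G. \<forall>x. norm x \<le> s * norm (G *v x) \<and> norm (G *v x) \<le> s * norm x}"

lemma norm_matrix_vector_mult_le: "norm (M *v x) \<le> norm M * norm (x::real^'n)" for M :: "real^'n^'n"
proof -
  have "norm (M *v x) = L2_set (\<lambda>i. \<bar>(M *v x) $ i\<bar>) UNIV" by (simp add: norm_vec_def)
  also have "\<dots> \<le> L2_set (\<lambda>i. norm (M $ i) * norm x) UNIV"
    by (intro L2_set_mono) (auto simp: matrix_vector_mul_component Cauchy_Schwarz_ineq2)
  also have "\<dots> = norm M * norm x"
    by (simp add: L2_set_left_distrib norm_vec_def)
  finally show ?thesis .
qed

lemma closed_near_isometries: "closed (near_isometries s)"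
proof -
  have c: "continuous_on UNIV (\<lambda>G::real^'n^'n. G *v x)" for x
    unfolding matrix_vector_mult_def by (intro continuous_intros)
  show ?thesis
    unfolding near_isometries_def
    by (intro closed_Collect_all closed_Collect_conj closed_Collect_le continuous_intros c)
qed

lemma near_isometries_measurable [measurable]: "near_isometries s \<in> sets borel"
  using closed_near_isometries by (rule borel_closed)

lemma emeasure_near_isometries_finite:
  "emeasure lborel (near_isometries s :: (real^'n^'n) set) < \<infinity>"
proof (rule emeasure_bounded_finite)
  have "norm G \<le> (\<Sum>i\<in>(UNIV::'n set). \<Sum>j\<in>(UNIV::'n set). s)" if "G \<in> near_isometries s" for G :: "real^'n^'n"
  proof -
    have "\<bar>G $ i $ j\<bar> \<le> s" for i j
    proof -
      have "G $ i $ j = (G *v axis j 1) $ i" by (simp add: column_def matrix_vector_mult_basis)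
      also have "\<bar>\<dots>\<bar> \<le> norm (G *v axis j 1)" by (rule component_le_norm_cart)
      also have "\<dots> \<le> s * norm (axis j 1 :: real^'n)" using that unfolding near_isometries_def by blast
      finally show ?thesis by (simp add: norm_axis_1)
    qed
    then have "(\<Sum>j\<in>UNIV. \<bar>G $ i $ j\<bar>) \<le> (\<Sum>j\<in>(UNIV::'n set). s)" for i
      by (intro sum_mono)
    then have "norm (G $ i) \<le> (\<Sum>j\<in>(UNIV::'n set). s)" for i
      using norm_le_l1_cart[of "G $ i"] order_trans by blast
    then have "(\<Sum>i\<in>UNIV. norm (G $ i)) \<le> (\<Sum>i\<in>(UNIV::'n set). \<Sum>j\<in>(UNIV::'n set). s)"
      by (intro sum_mono)
    moreover have "norm G \<le> (\<Sum>i\<in>UNIV. norm (G $ i))"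
      unfolding norm_vec_def[of G] by (rule L2_set_le_sum) simp
    ultimately show ?thesis using order_trans by blast
  qed
  then show "bounded (near_isometries s :: (real^'n^'n) set)" by (auto simp: bounded_iff)
qed

lemma emeasure_near_isometries_pos:
  assumes "s > 1"
  shows "emeasure lborel (near_isometries s :: (real^'n^'n) set) > 0"
proof -
  define \<delta> where "\<delta> = 1 - 1 / s"
  have "\<delta> > 0" using assms by (simp add: \<delta>_def)
  have "ball (mat 1) \<delta> \<subseteq> (near_isometries s :: (real^'n^'n) set)"
  proof
    fix G :: "real^'n^'n" assume "G \<in> ball (mat 1) \<delta>"
    then have G: "norm (G - mat 1) \<le> \<delta>" by (simp add: dist_norm norm_minus_commute)
    have d: "norm (G *v x - x) \<le> \<delta> * norm x" for x
    proof -
      have "G *v x - x = (G - mat 1) *v x" by (simp add: matrix_vector_mult_diff_rdistrib)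
      also have "norm \<dots> \<le> norm (G - mat 1) * norm x" by (rule norm_matrix_vector_mult_le)
      also have "\<dots> \<le> \<delta> * norm x" using G by (intro mult_right_mono) auto
      finally show ?thesis .
    qed
    have "norm x \<le> s * norm (G *v x)" for x
    proof -
      have "(1 - \<delta>) * norm x \<le> norm (G *v x)"
        using d[of x] norm_triangle_ineq2[of x "x - G *v x"]
        by (simp add: norm_minus_commute algebra_simps)
      then show ?thesis using assms by (simp add: \<delta>_def field_simps)
    qed
    moreover have "norm (G *v x) \<le> s * norm x" for x
    proof -
      have "2 \<le> s + 1 / s" using assms sum_squares_bound[of s 1]
        by (simp add: field_simps power2_eq_square)
      then have "1 + \<delta> \<le> s" by (simp add: \<delta>_def)
      then have "(1 + \<delta>) * norm x \<le> s * norm x" by (intro mult_right_mono) auto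
      moreover have "norm (G *v x) \<le> (1 + \<delta>) * norm x"
        using d[of x] norm_triangle_ineq[of x "G *v x - x"] by (simp add: algebra_simps)
      ultimately show ?thesis by simp
    qed
    ultimately show "G \<in> near_isometries s" by (auto simp: near_isometries_def)
  qed
  then have "emeasure lborel (ball (mat 1 :: real^'n^'n) \<delta>) \<le> emeasure lborel (near_isometries s :: (real^'n^'n) set)"
    by (intro emeasure_mono) auto
  moreover have "emeasure lborel (ball (mat 1 :: real^'n^'n) \<delta>) > 0"
    using \<open>\<delta> > 0\<close> emeasure_ball[of \<delta> "mat 1 :: real^'n^'n"] by simp
  ultimately show ?thesis by (rule less_le_trans[rotated])
qed

lemma near_isometries_mult_orthogonal:
  assumes "orthogonal_matrix R"
  shows "G ** R \<in> near_isometries s \<longleftrightarrow> G \<in> near_isometries s"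
proof -
  have n: "norm (R *v x) = norm x" for x
    using assms orthogonal_transformation_matrix[of "(*v) R"] orthogonal_transformation_norm
    by fastforce
  have s: "\<exists>y. x = R *v y" for x
    using assms by (intro exI[of _ "transpose R *v x"])
      (simp add: matrix_vector_mul_assoc orthogonal_matrix_def del: transpose_matrix_vector)
  show ?thesis
    unfolding near_isometries_def mem_Collect_eq matrix_vector_mul_assoc[symmetric]
    by (metis n s)
qed

text \<open>Right multiplication by an orthogonal matrix acts on every row by an orthogonal map, so it is an
isometry of the space of matrices.\<close>

lemma nn_integral_matrix_mult_orthogonal:
  fixes R :: "real^'n^'n" and f :: "real^'n^'n \<Rightarrow> ennreal"
  assumes "orthogonal_matrix R" "f \<in> borel_measurable borel"
  shows "(\<integral>\<^sup>+G. f (G ** R) \<partial>lborel) = (\<integral>\<^sup>+G. f G \<partial>lborel)"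
proof (rule nn_integral_isometry)
  have n: "norm (transpose R *v x) = norm x" for x
    using assms orthogonal_matrix_transpose[of R]
      orthogonal_transformation_matrix[of "(*v) (transpose R)"] orthogonal_transformation_norm
    by fastforce
  have row: "(G ** R) $ i = transpose R *v (G $ i)" for G :: "real^'n^'n" and i
    by (simp add: vec_eq_iff matrix_matrix_mult_def matrix_vector_mult_def transpose_def mult.commute)
  have "linear (\<lambda>G :: real^'n^'n. G ** R)"
    by (rule linearI) (simp_all add: vec_eq_iff matrix_matrix_mult_def sum.distrib sum_distrib_left algebra_simps)
  moreover have "norm (G ** R) = norm G" for G :: "real^'n^'n"
    unfolding norm_vec_def[of "G ** R"] norm_vec_def[of G] row n ..
  ultimately show "orthogonal_transformation (\<lambda>G :: real^'n^'n. G ** R)"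
    by (simp add: orthogonal_transformation)
qed fact

lemma plane_rotation:
  fixes j k :: "'n::finite" and t :: real
  assumes "j \<noteq> k"
  obtains R :: "real^'n^'n" where "orthogonal_matrix R"
    "R *v axis k 1 = cos t *\<^sub>R axis k 1 + sin t *\<^sub>R axis j 1"
    "R *v axis j 1 = (- sin t) *\<^sub>R axis k 1 + cos t *\<^sub>R axis j 1"
proof -
  define a b where "a = (axis k 1 :: real^'n)" and "b = (axis j 1 :: real^'n)"
  define f where "f v = v + ((cos t - 1) * (v \<bullet> a) - sin t * (v \<bullet> b)) *\<^sub>R a
    + (sin t * (v \<bullet> a) + (cos t - 1) * (v \<bullet> b)) *\<^sub>R b" for v
  have ab: "a \<bullet> a = 1" "b \<bullet> b = 1" "a \<bullet> b = 0" "b \<bullet> a = 0"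
    using assms by (auto simp: a_def b_def inner_axis_axis)
  have lin: "linear f"
    by (rule linearI) (simp_all add: f_def inner_add_left algebra_simps)
  have "f v \<bullet> f v = v \<bullet> v" for v
  proof -
    define x y C S where "x = v \<bullet> a" "y = v \<bullet> b" "C = cos t" "S = sin t"
    have cs: "C\<^sup>2 + S\<^sup>2 = 1" by (simp add: x_y_C_S_def)
    define A B where "A = (C - 1) * x - S * y" "B = S * x + (C - 1) * y"
    have "f v \<bullet> f v = v \<bullet> v + (2 * (A * x + B * y) + A\<^sup>2 + B\<^sup>2)"
      unfolding f_def x_y_C_S_def[symmetric] A_B_def[symmetric]
      by (simp add: inner_add_left inner_add_right ab inner_commute[of a v] inner_commute[of b v]
          x_y_C_S_def power2_eq_square algebra_simps)
    also have "2 * (A * x + B * y) + A\<^sup>2 + B\<^sup>2 = (C\<^sup>2 + S\<^sup>2 - 1) * (x\<^sup>2 + y\<^sup>2)"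
      unfolding A_B_def by (simp add: power2_eq_square algebra_simps)
    finally show ?thesis using cs by simp
  qed
  then have orth: "orthogonal_transformation f"
    using lin by (simp add: orthogonal_transformation norm_eq)
  show ?thesis
  proof (rule that[of "matrix f"])
    show "orthogonal_matrix (matrix f)" using orth orthogonal_transformation_matrix by blast
    show "matrix f *v axis k 1 = cos t *\<^sub>R axis k 1 + sin t *\<^sub>R axis j 1"
      "matrix f *v axis j 1 = (- sin t) *\<^sub>R axis k 1 + cos t *\<^sub>R axis j 1"
      unfolding matrix_vector_mul(2)[OF lin] a_def[symmetric] b_def[symmetric]
      by (simp_all add: f_def ab algebra_simps)
  qed
qed

section \<open>The Poincare inequality for odd functions\<close>

text \<open>For fixed \<open>G\<close> the curve \<open>t \<mapsto> r G (cos t e\<^sub>k + sin t e\<^sub>j)\<close> is an ellipse centred at the origin. Along it an odd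
function is antiperiodic, so Wirtinger's inequality applies. After integration over all \<open>G\<close> every
point of the curve contributes the same amount, because a rotation in the plane of \<open>e\<^sub>k\<close> and \<open>e\<^sub>j\<close> can be
absorbed into \<open>G\<close>.\<close>

lemma great_ellipse_poincare:
  fixes w :: "real^'n \<Rightarrow> real" and g :: "real^'n \<Rightarrow> real^'n" and j k :: 'n
  assumes deriv: "\<And>x. (w has_derivative (\<lambda>h. g x \<bullet> h)) (at x)"
    and contg: "continuous_on UNIV g"
    and odd: "\<And>x. w (- x) = - w x"
    and "j \<noteq> k"
  shows "(\<integral>\<^sup>+G. indicator (near_isometries s) G * ennreal ((w (r *\<^sub>R (G *v axis k 1)))\<^sup>2) \<partial>lborel)
    \<le> (\<integral>\<^sup>+G. indicator (near_isometries s) G *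
          ennreal ((g (r *\<^sub>R (G *v axis k 1)) \<bullet> (r *\<^sub>R (G *v axis j 1)))\<^sup>2) \<partial>lborel)"
    (is "?X \<le> ?Y")
proof -
  define c where "c t = cos t *\<^sub>R axis k 1 + sin t *\<^sub>R (axis j 1 :: real^'n)" for t
  define c' where "c' t = (- sin t) *\<^sub>R axis k 1 + cos t *\<^sub>R (axis j 1 :: real^'n)" for t
  define P where "P t G = w (r *\<^sub>R (G *v c t))" for t and G :: "real^'n^'n"
  define Q where "Q t G = g (r *\<^sub>R (G *v c t)) \<bullet> (r *\<^sub>R (G *v c' t))" for t and G :: "real^'n^'n"
  have contw: "continuous_on UNIV w"
    by (intro continuous_at_imp_continuous_on ballI has_derivative_continuous[OF deriv])
  have [measurable]: "w \<in> borel_measurable borel" "g \<in> borel_measurable borel"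
    using contw contg by (auto intro: borel_measurable_continuous_onI)
  have cGv [measurable]: "(\<lambda>G::real^'n^'n. G *v x) \<in> borel_measurable borel" for x
    unfolding matrix_vector_mult_def
    by (intro borel_measurable_continuous_onI continuous_intros)
  have cont_gen: "continuous_on UNIV (\<lambda>z :: real \<times> (real^'n^'n). snd z *v e (fst z))" if "continuous_on UNIV e"
    for e :: "real \<Rightarrow> real^'n"
  proof -
    have "continuous_on UNIV (\<lambda>z::real \<times> (real^'n^'n). e (fst z))"
      by (intro continuous_on_compose2[OF that] continuous_intros) auto
    then show ?thesis unfolding matrix_vector_mult_def by (intro continuous_intros)
  qed
  have cc: "continuous_on UNIV c" "continuous_on UNIV c'"
    unfolding c_def[abs_def] c'_def[abs_def] by (intro continuous_intros)+
  have cP: "continuous_on UNIV (\<lambda>z. P (fst z) (snd z))"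
    unfolding P_def by (intro continuous_on_compose2[OF contw] continuous_intros cont_gen cc) auto
  have cQ: "continuous_on UNIV (\<lambda>z. Q (fst z) (snd z))"
    unfolding Q_def
    by (intro continuous_on_inner continuous_on_compose2[OF contg] continuous_intros cont_gen cc) auto
  have mP [measurable]: "(\<lambda>z. P (fst z) (snd z)) \<in> borel_measurable (borel \<Otimes>\<^sub>M borel)"
    and mQ [measurable]: "(\<lambda>z. Q (fst z) (snd z)) \<in> borel_measurable (borel \<Otimes>\<^sub>M borel)"
    using cP cQ by (simp_all add: borel_prod borel_measurable_continuous_onI)
  have mP' [measurable]: "(\<lambda>t. P t G) \<in> borel_measurable borel"
    and mQ' [measurable]: "(\<lambda>t. Q t G) \<in> borel_measurable borel"
    and mP'' [measurable]: "(\<lambda>G. P t G) \<in> borel_measurable borel"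
    and mQ'' [measurable]: "(\<lambda>G. Q t G) \<in> borel_measurable borel" for G t
    using measurable_Pair1[OF mP, of G] measurable_Pair1[OF mQ, of G]
      measurable_Pair2[OF mP, of t] measurable_Pair2[OF mQ, of t] by simp_all
  have inv: "(\<integral>\<^sup>+G. indicator (near_isometries s) G * ennreal ((P t G)\<^sup>2) \<partial>lborel) = ?X"
    "(\<integral>\<^sup>+G. indicator (near_isometries s) G * ennreal ((Q t G)\<^sup>2) \<partial>lborel) = ?Y" for t
  proof -
    obtain R :: "real^'n^'n" where R: "orthogonal_matrix R" "R *v axis k 1 = c t" "R *v axis j 1 = c' t"
      using plane_rotation[OF \<open>j \<noteq> k\<close>, of t] unfolding c_def c'_def by metis
    have P: "P t G = w (r *\<^sub>R ((G ** R) *v axis k 1))"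
      and Q: "Q t G = g (r *\<^sub>R ((G ** R) *v axis k 1)) \<bullet> (r *\<^sub>R ((G ** R) *v axis j 1))" for G
      by (simp_all add: P_def Q_def matrix_vector_mul_assoc[symmetric] R)
    have I: "indicator (near_isometries s) G = (indicator (near_isometries s) (G ** R) :: ennreal)" for G
      using near_isometries_mult_orthogonal[OF R(1)] by (simp add: indicator_def)
    show "(\<integral>\<^sup>+G. indicator (near_isometries s) G * ennreal ((P t G)\<^sup>2) \<partial>lborel) = ?X"
      unfolding P by (subst I) (rule nn_integral_matrix_mult_orthogonal[OF R(1)], measurable)
    show "(\<integral>\<^sup>+G. indicator (near_isometries s) G * ennreal ((Q t G)\<^sup>2) \<partial>lborel) = ?Y"
      unfolding Q by (subst I) (rule nn_integral_matrix_mult_orthogonal[OF R(1)], measurable)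
  qed
  have wirt: "(\<integral>\<^sup>+t. indicator {0..pi} t * ennreal ((P t G)\<^sup>2) \<partial>lborel)
      \<le> (\<integral>\<^sup>+t. indicator {0..pi} t * ennreal ((Q t G)\<^sup>2) \<partial>lborel)" for G
  proof -
    have d: "((\<lambda>t. P t G) has_real_derivative Q t G) (at t)" for t
    proof -
      have "((\<lambda>t. r *\<^sub>R (G *v c t)) has_derivative (\<lambda>h. r *\<^sub>R (G *v (h *\<^sub>R c' t)))) (at t)"
        unfolding c_def[abs_def] c'_def
        by (auto intro!: derivative_eq_intros bounded_linear.has_derivative[OF matrix_vector_mul_bounded_linear[of G]]
            simp: algebra_simps)
      from diff_chain_at[OF this deriv]
      have "((\<lambda>t. P t G) has_derivative
          (\<lambda>h. g (r *\<^sub>R (G *v c t)) \<bullet> (r *\<^sub>R (G *v (h *\<^sub>R c' t))))) (at t)"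
        by (simp only: o_def P_def[abs_def])
      moreover have "(\<lambda>h. g (r *\<^sub>R (G *v c t)) \<bullet> (r *\<^sub>R (G *v (h *\<^sub>R c' t)))) = (*) (Q t G)"
        by (auto simp: fun_eq_iff Q_def matrix_vector_mult_scaleR)
      ultimately show ?thesis by (simp add: has_field_derivative_def)
    qed
    have contQ: "continuous_on UNIV (\<lambda>t. Q t G)"
      using continuous_on_compose2[OF cQ, of UNIV "\<lambda>t. (t, G)"] by (simp add: continuous_intros)
    have contP: "continuous_on UNIV (\<lambda>t. P t G)"
      using continuous_on_compose2[OF cP, of UNIV "\<lambda>t. (t, G)"] by (simp add: continuous_intros)
    have anti: "P (t + pi) G = - P t G" for t
    proof -
      have "c (t + pi) = - c t" by (simp add: c_def algebra_simps)
      moreover have "G *v (- v) = - (G *v v)" for v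
        using matrix_vector_mult_scaleR[of G "-1" v] by simp
      ultimately show ?thesis by (simp add: P_def odd)
    qed
    have W: "integral {0..pi} (\<lambda>t. (P t G)\<^sup>2) \<le> integral {0..pi} (\<lambda>t. (Q t G)\<^sup>2)"
      using wirtinger_antiperiodic[OF d contQ anti] .
    have conv: "(\<integral>\<^sup>+t. indicator {0..pi} t * ennreal ((f t)\<^sup>2) \<partial>lborel) = ennreal (integral {0..pi} (\<lambda>t. (f t)\<^sup>2))"
      if "continuous_on UNIV f" for f :: "real \<Rightarrow> real"
    proof -
      have "((\<lambda>t. (f t)\<^sup>2) has_integral integral {0..pi} (\<lambda>t. (f t)\<^sup>2)) {0..pi}"
        by (intro integrable_integral integrable_continuous_real continuous_intros
            continuous_on_subset[OF that]) auto
      from nn_integral_has_integral_lebesgue[OF _ this] show ?thesis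
        by (simp add: ennreal_mult' ennreal_indicator)
    qed
    show ?thesis unfolding conv[OF contP] conv[OF contQ] using W by (rule ennreal_leI)
  qed
  \<comment> \<open>By \<open>inv\<close> the inner integral over \<open>G\<close> is constant in \<open>t\<close>, so the angle contributes the length \<open>pi\<close>.\<close>
  have avg: "(\<integral>\<^sup>+G. indicator (near_isometries s) G * (\<integral>\<^sup>+t. indicator {0..pi} t * ennreal ((f t G)\<^sup>2) \<partial>lborel) \<partial>lborel)
      = ennreal pi * I"
    if [measurable]: "(\<lambda>z. f (fst z) (snd z)) \<in> borel_measurable (borel \<Otimes>\<^sub>M borel)"
      and I: "\<And>t. (\<integral>\<^sup>+G. indicator (near_isometries s) G * ennreal ((f t G)\<^sup>2) \<partial>lborel) = I"
    for f :: "real \<Rightarrow> real^'n^'n \<Rightarrow> real" and I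
  proof -
    have [measurable]: "(\<lambda>t. f t G) \<in> borel_measurable borel" "(\<lambda>G. f t G) \<in> borel_measurable borel" for t G
      using measurable_Pair1[OF that(1), of G] measurable_Pair2[OF that(1), of t] by simp_all
    have "(\<integral>\<^sup>+G. indicator (near_isometries s) G * (\<integral>\<^sup>+t. indicator {0..pi} t * ennreal ((f t G)\<^sup>2) \<partial>lborel) \<partial>lborel)
      = (\<integral>\<^sup>+G. (\<integral>\<^sup>+t. indicator {0..pi} t * (indicator (near_isometries s) G * ennreal ((f t G)\<^sup>2)) \<partial>lborel) \<partial>lborel)"
      by (subst nn_integral_cmult[symmetric]) (auto simp: ac_simps)
    also have "\<dots> = (\<integral>\<^sup>+t. (\<integral>\<^sup>+G. indicator {0..pi} t * (indicator (near_isometries s) G * ennreal ((f t G)\<^sup>2)) \<partial>lborel) \<partial>lborel)"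
      by (rule lborel_pair.Fubini') (simp add: split_beta')
    also have "\<dots> = (\<integral>\<^sup>+t. indicator {0..pi} t * I \<partial>lborel)"
      by (subst nn_integral_cmult) (auto simp: I)
    also have "\<dots> = ennreal pi * I"
      by (subst nn_integral_multc) auto
    finally show ?thesis .
  qed
  have "ennreal pi * ?X \<le> ennreal pi * ?Y"
    unfolding avg[OF mP inv(1), symmetric] avg[OF mQ inv(2), symmetric]
    by (intro nn_integral_mono mult_left_mono wirt) auto
  then show ?thesis by (simp add: ennreal_mult_le_mult_iff)
qed

text \<open>Summing over the \<open>d - 1\<close> directions \<open>e\<^sub>j\<close> other than \<open>e\<^sub>k\<close> collects the squared components of \<open>G\<^sup>T \<nabla>w\<close>, at most
\<open>s\<^sup>2 \<bar>\<nabla>w\<bar>\<^sup>2\<close>. A rotation that takes \<open>\<bar>x\<bar> e\<^sub>k\<close> to \<open>x\<close> then replaces the special point by an arbitrary one.\<close>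

lemma odd_poincare_near_isometries:
  fixes w :: "real^'n \<Rightarrow> real" and g :: "real^'n \<Rightarrow> real^'n"
  assumes deriv: "\<And>x. (w has_derivative (\<lambda>h. g x \<bullet> h)) (at x)"
    and contg: "continuous_on UNIV g"
    and odd: "\<And>x. w (- x) = - w x" and "s \<ge> 1"
  shows "ennreal (real CARD('n) - 1) *
      (\<integral>\<^sup>+G. indicator (near_isometries s) G * ennreal ((w (G *v x))\<^sup>2) \<partial>lborel)
    \<le> ennreal (s\<^sup>2 * (norm x)\<^sup>2) *
      (\<integral>\<^sup>+G. indicator (near_isometries s) G * ennreal ((norm (g (G *v x)))\<^sup>2) \<partial>lborel)"
proof -
  fix k :: 'n
  define r where "r = norm x"
  have contw: "continuous_on UNIV w"
    by (intro continuous_at_imp_continuous_on ballI has_derivative_continuous[OF deriv])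
  have [measurable]: "w \<in> borel_measurable borel" "g \<in> borel_measurable borel"
    using contw contg by (auto intro: borel_measurable_continuous_onI)
  have [measurable]: "(\<lambda>G::real^'n^'n. G *v y) \<in> borel_measurable borel" for y
    unfolding matrix_vector_mult_def
    by (intro borel_measurable_continuous_onI continuous_intros)
  define X where "X = (\<integral>\<^sup>+G. indicator (near_isometries s) G * ennreal ((w (r *\<^sub>R (G *v axis k 1)))\<^sup>2) \<partial>lborel)"
  define Y where "Y j = (\<integral>\<^sup>+G. indicator (near_isometries s) G *
          ennreal ((g (r *\<^sub>R (G *v axis k 1)) \<bullet> (r *\<^sub>R (G *v axis j 1)))\<^sup>2) \<partial>lborel)" for j
  \<comment> \<open>The transpose of \<open>G\<close> has the same operator norm as \<open>G\<close>.\<close>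
  have tr: "(norm (transpose G *v a))\<^sup>2 \<le> s\<^sup>2 * (norm a)\<^sup>2" if "G \<in> near_isometries s" for G :: "real^'n^'n" and a
  proof -
    define b where "b = transpose G *v a"
    have "(norm b)\<^sup>2 = b \<bullet> (transpose G *v a)" by (simp add: b_def power2_norm_eq_inner)
    also have "\<dots> = (G *v b) \<bullet> a"
      by (metis dot_lmul_matrix inner_commute transpose_matrix_vector)
    also have "\<dots> \<le> norm (G *v b) * norm a" by (rule norm_cauchy_schwarz)
    also have "\<dots> \<le> (s * norm b) * norm a"
      using that by (intro mult_right_mono) (auto simp: near_isometries_def)
    finally have "norm b * norm b \<le> norm b * (s * norm a)" by (simp add: power2_eq_square ac_simps)
    then have "norm b \<le> s * norm a" using \<open>s \<ge> 1\<close>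
      by (cases "b = 0") (auto simp: mult_le_cancel_left)
    then have "(norm b)\<^sup>2 \<le> (s * norm a)\<^sup>2" by (intro power_mono) auto
    then show ?thesis by (simp add: b_def power_mult_distrib)
  qed
  have "real CARD('n) - 1 = real (card (UNIV - {k}))"
    by (simp add: card_Diff_singleton of_nat_diff)
  then have "ennreal (real CARD('n) - 1) * X = (\<Sum>j\<in>UNIV - {k}. X)"
    by (simp add: ennreal_of_nat_eq_real_of_nat)
  also have "\<dots> \<le> (\<Sum>j\<in>UNIV - {k}. Y j)"
    unfolding X_def Y_def by (intro sum_mono great_ellipse_poincare[OF deriv contg odd]) auto
  also have "\<dots> = (\<integral>\<^sup>+G. (\<Sum>j\<in>UNIV - {k}. indicator (near_isometries s) G *
          ennreal ((g (r *\<^sub>R (G *v axis k 1)) \<bullet> (r *\<^sub>R (G *v axis j 1)))\<^sup>2)) \<partial>lborel)"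
    unfolding Y_def by (rule nn_integral_sum[symmetric]) measurable
  also have "\<dots> \<le> (\<integral>\<^sup>+G. ennreal (s\<^sup>2 * r\<^sup>2) * (indicator (near_isometries s) G *
          ennreal ((norm (g (r *\<^sub>R (G *v axis k 1))))\<^sup>2)) \<partial>lborel)"
  proof (rule nn_integral_mono)
    fix G :: "real^'n^'n"
    define a where "a = g (r *\<^sub>R (G *v axis k 1))"
    have "(\<Sum>j\<in>UNIV - {k}. (a \<bullet> (r *\<^sub>R (G *v axis j 1)))\<^sup>2) \<le> s\<^sup>2 * r\<^sup>2 * (norm a)\<^sup>2"
      if G: "G \<in> near_isometries s"
    proof -
      have "a \<bullet> (G *v axis j 1) = (transpose G *v a) $ j" for j
        by (metis dot_lmul_matrix inner_axis inner_real_def mult.right_neutral transpose_matrix_vector)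
      then have "(\<Sum>j\<in>UNIV - {k}. (a \<bullet> (r *\<^sub>R (G *v axis j 1)))\<^sup>2)
          \<le> (\<Sum>j\<in>UNIV. r\<^sup>2 * ((transpose G *v a) $ j)\<^sup>2)"
        by (simp only: inner_scaleR_right power_mult_distrib) (intro sum_mono2, auto)
      also have "\<dots> = r\<^sup>2 * (norm (transpose G *v a))\<^sup>2"
        unfolding power2_norm_eq_inner inner_vec_def
        by (simp only: sum_distrib_left inner_real_def power2_eq_square)
      also have "\<dots> \<le> r\<^sup>2 * (s\<^sup>2 * (norm a)\<^sup>2)" by (intro mult_left_mono tr G) auto
      finally show ?thesis by (simp add: ac_simps)
    qed
    then show "(\<Sum>j\<in>UNIV - {k}. indicator (near_isometries s) G *
          ennreal ((g (r *\<^sub>R (G *v axis k 1)) \<bullet> (r *\<^sub>R (G *v axis j 1)))\<^sup>2))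
      \<le> ennreal (s\<^sup>2 * r\<^sup>2) * (indicator (near_isometries s) G *
          ennreal ((norm (g (r *\<^sub>R (G *v axis k 1))))\<^sup>2))"
      unfolding a_def[symmetric]
      by (cases "G \<in> near_isometries s") (simp_all add: ennreal_mult[symmetric] ennreal_leI)
  qed
  also have "\<dots> = ennreal (s\<^sup>2 * r\<^sup>2) * (\<integral>\<^sup>+G. indicator (near_isometries s) G *
          ennreal ((norm (g (r *\<^sub>R (G *v axis k 1))))\<^sup>2) \<partial>lborel)"
    by (rule nn_integral_cmult) measurable
  finally have main: "ennreal (real CARD('n) - 1) * X \<le> \<dots>" .
  have "norm (r *\<^sub>R (axis k 1 :: real^'n)) = norm x" by (simp add: r_def norm_axis_1)
  from orthogonal_transformation_exists[OF this] obtain f :: "real^'n \<Rightarrow> real^'n"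
    where f: "orthogonal_transformation f" "f (r *\<^sub>R axis k 1) = x" by blast
  define R where "R = matrix f"
  have R: "orthogonal_matrix R" "R *v (r *\<^sub>R axis k 1) = x"
    using f orthogonal_transformation_matrix[of f] orthogonal_transformation_linear[OF f(1)]
    by (simp_all add: R_def matrix_vector_mul(2))
  have Rx: "G *v x = r *\<^sub>R ((G ** R) *v axis k 1)" for G :: "real^'n^'n"
    by (simp add: R(2)[symmetric] matrix_vector_mul_assoc matrix_vector_mult_scaleR)
  have I: "indicator (near_isometries s) G = (indicator (near_isometries s) (G ** R) :: ennreal)" for G
    using near_isometries_mult_orthogonal[OF R(1)] by (simp add: indicator_def)
  have "(\<integral>\<^sup>+G. indicator (near_isometries s) G * ennreal ((w (G *v x))\<^sup>2) \<partial>lborel) = X"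
    unfolding X_def Rx by (subst I) (rule nn_integral_matrix_mult_orthogonal[OF R(1)], measurable)
  moreover have "(\<integral>\<^sup>+G. indicator (near_isometries s) G * ennreal ((norm (g (G *v x)))\<^sup>2) \<partial>lborel)
    = (\<integral>\<^sup>+G. indicator (near_isometries s) G *
          ennreal ((norm (g (r *\<^sub>R (G *v axis k 1))))\<^sup>2) \<partial>lborel)"
    unfolding Rx by (subst I) (rule nn_integral_matrix_mult_orthogonal[OF R(1)], measurable)
  ultimately show ?thesis using main by (simp add: r_def)
qed

text \<open>The inequality on the orbit of a point is integrated against \<open>\<bar>x\<bar>\<^sup>-\<^sup>d\<close>. Interchanging the integrals and
substituting \<open>z = G x\<close> for fixed \<open>G\<close> leaves the two integrals of the statement, each multiplied by the measure of
the set of near isometries; what is lost is a power of \<open>s\<close>.\<close>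

lemma odd_poincare_weighted_nn:
  fixes w :: "real^'n \<Rightarrow> real" and g :: "real^'n \<Rightarrow> real^'n"
  assumes deriv: "\<And>x. (w has_derivative (\<lambda>h. g x \<bullet> h)) (at x)"
    and contg: "continuous_on UNIV g"
    and odd: "\<And>x. w (- x) = - w x"
  shows "ennreal (real CARD('n) - 1) * (\<integral>\<^sup>+x. ennreal ((w x)\<^sup>2 / norm x ^ CARD('n)) \<partial>lborel)
    \<le> (\<integral>\<^sup>+x. ennreal ((norm (g x))\<^sup>2 * (norm x)\<^sup>2 / norm x ^ CARD('n)) \<partial>lborel)"
    (is "?d * ?A \<le> ?B")
proof -
  define n where "n = CARD('n)"
  have contw: "continuous_on UNIV w"
    by (intro continuous_at_imp_continuous_on ballI has_derivative_continuous[OF deriv])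
  have [measurable]: "w \<in> borel_measurable borel" "g \<in> borel_measurable borel"
    using contw contg by (auto intro: borel_measurable_continuous_onI)
  have "continuous_on UNIV (\<lambda>z::(real^'n) \<times> (real^'n^'n). snd z *v fst z)"
    unfolding matrix_vector_mult_def by (intro continuous_intros)
  then have mv: "(\<lambda>z::(real^'n) \<times> (real^'n^'n). snd z *v fst z) \<in> borel_measurable (borel \<Otimes>\<^sub>M borel)"
    by (simp add: borel_prod borel_measurable_continuous_onI)
  have [measurable]: "(\<lambda>z::(real^'n) \<times> (real^'n^'n). w (snd z *v fst z)) \<in> borel_measurable (borel \<Otimes>\<^sub>M borel)"
    "(\<lambda>z::(real^'n) \<times> (real^'n^'n). g (snd z *v fst z)) \<in> borel_measurable (borel \<Otimes>\<^sub>M borel)"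
    by (simp_all add: measurable_compose[OF mv])
  have [measurable]: "(\<lambda>x. G *v x) \<in> borel_measurable borel" "(\<lambda>H :: real^'n^'n. H *v x) \<in> borel_measurable borel"
    for G :: "real^'n^'n" and x :: "real^'n"
    using measurable_Pair1[OF mv, of G] measurable_Pair2[OF mv, of x] by simp_all
  have step: "?d * ?A \<le> ennreal (s ^ (4 * n + 4)) * ?B" if "s > 1" for s :: real
  proof -
    define N where "N = (near_isometries s :: (real^'n^'n) set)"
    have [measurable]: "N \<in> sets borel" unfolding N_def by simp
    define v where "v = emeasure lborel N"
    have v: "v \<noteq> 0" "v < top"
      using emeasure_near_isometries_pos[where 'n='n, OF that] emeasure_near_isometries_finite[where 'n='n, of s]
      by (auto simp: v_def N_def)
    have N: "norm x \<le> s * norm (G *v x)" "norm (G *v x) \<le> s * norm x" if "G \<in> N" for G x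
      using that by (auto simp: N_def near_isometries_def)
    have inv_le: "1 / a ^ n \<le> s ^ n * (1 / b ^ n)" if "b \<le> s * a" "a \<le> s * b" "0 \<le> a" for a b :: real
    proof (cases "a = 0")
      case True
      then show ?thesis using that \<open>s > 1\<close> by (cases "n = 0") (auto simp: power_0_left zero_le_mult_iff)
    next
      case False
      then have "a > 0" using that by simp
      then have "0 < s * b" using that by linarith
      then have "b > 0" using \<open>s > 1\<close> by (simp add: zero_less_mult_iff)
      then have "b ^ n \<le> s ^ n * a ^ n" using that by (simp add: power_mult_distrib[symmetric] power_mono)
      then show ?thesis using \<open>a > 0\<close> \<open>b > 0\<close> by (simp add: field_simps)
    qed
    have lin: "linear (\<lambda>x. G *v x)" for G :: "real^'n^'n" by simp
    have A: "?A \<le> ennreal (s ^ (2 * n)) * (\<integral>\<^sup>+x. ennreal (1 / norm x ^ n) * ennreal ((w (G *v x))\<^sup>2) \<partial>lborel)"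
      if G: "G \<in> N" for G
    proof -
      have "?A \<le> ennreal (s ^ n) * (\<integral>\<^sup>+x. ennreal ((w (G *v x))\<^sup>2 / norm (G *v x) ^ n) \<partial>lborel)"
        using nn_integral_near_isometry_ge[OF lin[of G], of s "\<lambda>x. ennreal ((w x)\<^sup>2 / norm x ^ CARD('n))"]
          N[OF G] \<open>s > 1\<close> by (simp add: n_def)
      also have "\<dots> \<le> ennreal (s ^ n) * (\<integral>\<^sup>+x. ennreal (s ^ n) * (ennreal (1 / norm x ^ n) * ennreal ((w (G *v x))\<^sup>2)) \<partial>lborel)"
      proof (intro mult_left_mono nn_integral_mono)
        fix x
        have "1 / norm (G *v x) ^ n * (w (G *v x))\<^sup>2 \<le> s ^ n * (1 / norm x ^ n) * (w (G *v x))\<^sup>2"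
          using inv_le[of "norm x" "norm (G *v x)"] N[OF G, of x] by (intro mult_right_mono) auto
        then show "ennreal ((w (G *v x))\<^sup>2 / norm (G *v x) ^ n)
            \<le> ennreal (s ^ n) * (ennreal (1 / norm x ^ n) * ennreal ((w (G *v x))\<^sup>2))"
          using \<open>s > 1\<close> by (simp add: ennreal_mult[symmetric] ennreal_leI ac_simps)
      qed auto
      also have "\<dots> = ennreal (s ^ (2 * n)) * (\<integral>\<^sup>+x. ennreal (1 / norm x ^ n) * ennreal ((w (G *v x))\<^sup>2) \<partial>lborel)"
        using \<open>s > 1\<close> by (subst nn_integral_cmult)
          (simp_all add: mult.assoc[symmetric] ennreal_mult[symmetric] mult_2 power_add)
      finally show ?thesis .
    qed
    have B: "(\<integral>\<^sup>+x. ennreal ((norm x)\<^sup>2 / norm x ^ n) * ennreal ((norm (g (G *v x)))\<^sup>2) \<partial>lborel) \<le> ennreal (s ^ (2 * n + 2)) * ?B"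
      if G: "G \<in> N" for G
    proof -
      have "(\<integral>\<^sup>+x. ennreal ((norm x)\<^sup>2 / norm x ^ n) * ennreal ((norm (g (G *v x)))\<^sup>2) \<partial>lborel)
        \<le> (\<integral>\<^sup>+x. ennreal (s ^ (n + 2)) * ennreal ((norm (g (G *v x)))\<^sup>2 * (norm (G *v x))\<^sup>2 / norm (G *v x) ^ n) \<partial>lborel)"
      proof (intro nn_integral_mono)
        fix x
        have "1 / norm x ^ n \<le> s ^ n * (1 / norm (G *v x) ^ n)"
          using inv_le[of "norm (G *v x)" "norm x"] N[OF G, of x] by auto
        moreover have "(norm x)\<^sup>2 \<le> s\<^sup>2 * (norm (G *v x))\<^sup>2"
          using N[OF G, of x] by (simp add: power_mult_distrib[symmetric] power_mono)
        ultimately have "(norm x)\<^sup>2 * (1 / norm x ^ n)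
            \<le> (s\<^sup>2 * (norm (G *v x))\<^sup>2) * (s ^ n * (1 / norm (G *v x) ^ n))"
          using \<open>s > 1\<close> by (intro mult_mono) auto
        then have "(norm x)\<^sup>2 * (1 / norm x ^ n) * (norm (g (G *v x)))\<^sup>2
            \<le> (s\<^sup>2 * (norm (G *v x))\<^sup>2) * (s ^ n * (1 / norm (G *v x) ^ n)) * (norm (g (G *v x)))\<^sup>2"
          by (rule mult_right_mono) simp
        then show "ennreal ((norm x)\<^sup>2 / norm x ^ n) * ennreal ((norm (g (G *v x)))\<^sup>2)
          \<le> ennreal (s ^ (n + 2)) * ennreal ((norm (g (G *v x)))\<^sup>2 * (norm (G *v x))\<^sup>2 / norm (G *v x) ^ n)"
          using \<open>s > 1\<close> by (simp add: ennreal_mult[symmetric] ennreal_leI ac_simps power_add power2_eq_square)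
      qed
      also have "\<dots> = ennreal (s ^ (n + 2)) * (\<integral>\<^sup>+x. ennreal ((norm (g (G *v x)))\<^sup>2 * (norm (G *v x))\<^sup>2 / norm (G *v x) ^ n) \<partial>lborel)"
        by (rule nn_integral_cmult) measurable
      also have "\<dots> \<le> ennreal (s ^ (n + 2)) * (ennreal (s ^ n) * ?B)"
        using nn_integral_near_isometry_le[OF lin[of G], of s "\<lambda>x. ennreal ((norm (g x))\<^sup>2 * (norm x)\<^sup>2 / norm x ^ CARD('n))"]
          N[OF G] \<open>s > 1\<close> by (intro mult_left_mono) (simp_all add: n_def)
      also have "\<dots> = ennreal (s ^ (2 * n + 2)) * ?B"
      proof -
        have "ennreal (s ^ (n + 2)) * ennreal (s ^ n) = ennreal (s ^ (2 * n + 2))"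
          using \<open>s > 1\<close> by (simp add: ennreal_mult[symmetric] power_add[symmetric] mult_2 add.commute add.left_commute)
        then show ?thesis by (simp only: mult.assoc[symmetric])
      qed
      finally show ?thesis .
    qed
    have "(?d * ?A) * v = (\<integral>\<^sup>+G. indicator N G * (?d * ?A) \<partial>lborel)"
      by (subst nn_integral_multc) (simp_all add: v_def mult.commute)
    also have "\<dots> \<le> (\<integral>\<^sup>+G. indicator N G * (?d * (ennreal (s ^ (2 * n)) * (\<integral>\<^sup>+x. ennreal (1 / norm x ^ n) * ennreal ((w (G *v x))\<^sup>2) \<partial>lborel))) \<partial>lborel)"
      by (intro nn_integral_mono) (auto simp: indicator_def intro!: mult_left_mono A)
    also have "\<dots> = (\<integral>\<^sup>+G. (\<integral>\<^sup>+x. ennreal (s ^ (2 * n)) * ennreal (1 / norm x ^ n) * (?d * (indicator N G * ennreal ((w (G *v x))\<^sup>2))) \<partial>lborel) \<partial>lborel)"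
      by (subst nn_integral_cmult[symmetric], simp, subst nn_integral_cmult[symmetric], simp,
        subst nn_integral_cmult[symmetric], simp, simp add: ac_simps)
    also have "\<dots> = (\<integral>\<^sup>+x. (\<integral>\<^sup>+G. ennreal (s ^ (2 * n)) * ennreal (1 / norm x ^ n) * (?d * (indicator N G * ennreal ((w (G *v x))\<^sup>2))) \<partial>lborel) \<partial>lborel)"
      by (rule lborel_pair.Fubini') (simp add: split_beta')
    also have "\<dots> = (\<integral>\<^sup>+x. ennreal (s ^ (2 * n)) * ennreal (1 / norm x ^ n) * (?d * (\<integral>\<^sup>+G. indicator N G * ennreal ((w (G *v x))\<^sup>2) \<partial>lborel)) \<partial>lborel)"
      by (simp add: nn_integral_cmult)
    also have "\<dots> \<le> (\<integral>\<^sup>+x. ennreal (s ^ (2 * n)) * ennreal (1 / norm x ^ n) * (ennreal (s\<^sup>2 * (norm x)\<^sup>2) * (\<integral>\<^sup>+G. indicator N G * ennreal ((norm (g (G *v x)))\<^sup>2) \<partial>lborel)) \<partial>lborel)"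
      using that unfolding N_def
      by (intro nn_integral_mono mult_left_mono odd_poincare_near_isometries[OF deriv contg odd]) auto
    also have "\<dots> = (\<integral>\<^sup>+x. (\<integral>\<^sup>+G. ennreal (s ^ (2 * n + 2)) * (indicator N G * (ennreal ((norm x)\<^sup>2 / norm x ^ n) * ennreal ((norm (g (G *v x)))\<^sup>2))) \<partial>lborel) \<partial>lborel)"
    proof (rule nn_integral_cong)
      fix x :: "real^'n"
      define E where "E = (norm x)\<^sup>2 / norm x ^ n"
      have E: "s ^ (2 * n + 2) * E = s ^ (2 * n) * (1 / norm x ^ n) * (s\<^sup>2 * (norm x)\<^sup>2)"
        by (simp add: E_def power_add power2_eq_square)
      have "(\<integral>\<^sup>+G. ennreal (s ^ (2 * n + 2)) * (indicator N G * (ennreal E * ennreal ((norm (g (G *v x)))\<^sup>2))) \<partial>lborel)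
        = (\<integral>\<^sup>+G. ennreal (s ^ (2 * n + 2)) * ennreal E * (indicator N G * ennreal ((norm (g (G *v x)))\<^sup>2)) \<partial>lborel)"
        by (simp only: ac_simps)
      also have "\<dots> = ennreal (s ^ (2 * n + 2)) * ennreal E * (\<integral>\<^sup>+G. indicator N G * ennreal ((norm (g (G *v x)))\<^sup>2) \<partial>lborel)"
        by (rule nn_integral_cmult) measurable
      also have "ennreal (s ^ (2 * n + 2)) * ennreal E = ennreal (s ^ (2 * n)) * ennreal (1 / norm x ^ n) * ennreal (s\<^sup>2 * (norm x)\<^sup>2)"
      proof -
        have nn: "0 \<le> s ^ (2 * n + 2)" "0 \<le> E" "0 \<le> s ^ (2 * n)" "0 \<le> 1 / norm x ^ n"
          "0 \<le> s ^ (2 * n) * (1 / norm x ^ n)" "0 \<le> s\<^sup>2 * (norm x)\<^sup>2"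
          using that by (auto simp: E_def)
        show ?thesis
          unfolding ennreal_mult[OF nn(1,2), symmetric] ennreal_mult[OF nn(3,4), symmetric]
            ennreal_mult[OF nn(5,6), symmetric] E ..
      qed
      finally show "ennreal (s ^ (2 * n)) * ennreal (1 / norm x ^ n) * (ennreal (s\<^sup>2 * (norm x)\<^sup>2) * (\<integral>\<^sup>+G. indicator N G * ennreal ((norm (g (G *v x)))\<^sup>2) \<partial>lborel))
        = (\<integral>\<^sup>+G. ennreal (s ^ (2 * n + 2)) * (indicator N G * (ennreal ((norm x)\<^sup>2 / norm x ^ n) * ennreal ((norm (g (G *v x)))\<^sup>2))) \<partial>lborel)"
        by (simp only: E_def mult.assoc)
    qed
    also have "\<dots> = (\<integral>\<^sup>+G. (\<integral>\<^sup>+x. ennreal (s ^ (2 * n + 2)) * (indicator N G * (ennreal ((norm x)\<^sup>2 / norm x ^ n) * ennreal ((norm (g (G *v x)))\<^sup>2))) \<partial>lborel) \<partial>lborel)"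
      by (rule lborel_pair.Fubini'[symmetric]) (simp add: split_beta')
    also have "\<dots> = (\<integral>\<^sup>+G. ennreal (s ^ (2 * n + 2)) * (indicator N G * (\<integral>\<^sup>+x. ennreal ((norm x)\<^sup>2 / norm x ^ n) * ennreal ((norm (g (G *v x)))\<^sup>2) \<partial>lborel)) \<partial>lborel)"
      by (simp add: nn_integral_cmult)
    also have "\<dots> \<le> (\<integral>\<^sup>+G. ennreal (s ^ (2 * n + 2)) * (indicator N G * (ennreal (s ^ (2 * n + 2)) * ?B)) \<partial>lborel)"
    proof (rule nn_integral_mono)
      fix G
      have "indicator N G * (\<integral>\<^sup>+x. ennreal ((norm x)\<^sup>2 / norm x ^ n) * ennreal ((norm (g (G *v x)))\<^sup>2) \<partial>lborel)
          \<le> indicator N G * (ennreal (s ^ (2 * n + 2)) * ?B)"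
        using B[of G] by (cases "G \<in> N") (simp_all only: indicator_simps mult_1_left mult_zero_left order_refl simp_thms)
      then show "ennreal (s ^ (2 * n + 2)) * (indicator N G * (\<integral>\<^sup>+x. ennreal ((norm x)\<^sup>2 / norm x ^ n) * ennreal ((norm (g (G *v x)))\<^sup>2) \<partial>lborel))
          \<le> ennreal (s ^ (2 * n + 2)) * (indicator N G * (ennreal (s ^ (2 * n + 2)) * ?B))"
        by (rule mult_left_mono) simp
    qed
    also have "\<dots> = ennreal (s ^ (4 * n + 4)) * ?B * v"
    proof -
      have "(\<integral>\<^sup>+G. ennreal (s ^ (2 * n + 2)) * (indicator N G * (ennreal (s ^ (2 * n + 2)) * ?B)) \<partial>lborel)
        = ennreal (s ^ (2 * n + 2)) * (v * (ennreal (s ^ (2 * n + 2)) * ?B))"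
        by (subst nn_integral_cmult, simp, subst nn_integral_multc, simp, simp add: v_def)
      also have "\<dots> = (ennreal (s ^ (2 * n + 2)) * ennreal (s ^ (2 * n + 2))) * ?B * v"
        by (simp add: ac_simps)
      also have "ennreal (s ^ (2 * n + 2)) * ennreal (s ^ (2 * n + 2)) = ennreal (s ^ (4 * n + 4))"
      proof -
        have "s ^ (4 * n + 4) = s ^ ((2 * n + 2) + (2 * n + 2))"
          by (rule arg_cong[where f = "\<lambda>k. s ^ k"]) simp
        then have "s ^ (4 * n + 4) = s ^ (2 * n + 2) * s ^ (2 * n + 2)"
          by (simp only: power_add[of s "2 * n + 2"])
        then show ?thesis using that by (simp only:) (rule ennreal_mult[symmetric], auto)
      qed
      finally show ?thesis .
    qed
    finally have "v * (?d * ?A) \<le> v * (ennreal (s ^ (4 * n + 4)) * ?B)" by (simp add: ac_simps)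
    then show ?thesis using v by (simp add: ennreal_mult_le_mult_iff)
  qed
  show ?thesis
  proof (cases "?B = top")
    case True
    then show ?thesis by simp
  next
    case False
    then obtain b where b: "?B = ennreal b" "b \<ge> 0" by (cases ?B) auto
    have "?d * ?A \<le> ennreal (2 ^ (4 * n + 4) * b)"
      using step[of 2] b by (simp add: ennreal_mult'[symmetric])
    then obtain x where x: "?d * ?A = ennreal x" "x \<ge> 0"
      by (cases "?d * ?A") (auto simp: top_unique)
    have "x \<le> s ^ (4 * n + 4) * b" if "s > 1" for s :: real
      using step[OF that] that b x by (simp add: ennreal_mult[symmetric])
    then have "eventually (\<lambda>s. x \<le> s ^ (4 * n + 4) * b) (at_right (1::real))"
      by (auto simp: eventually_at_filter)
    moreover have "((\<lambda>s. s ^ (4 * n + 4) * b) \<longlongrightarrow> 1 ^ (4 * n + 4) * b) (at_right (1::real))"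
      by (intro tendsto_intros)
    ultimately have "x \<le> 1 ^ (4 * n + 4) * b"
      by (intro tendsto_lowerbound[of _ _ "at_right (1::real)"]) auto
    then show ?thesis using x b by (simp add: ennreal_leI)
  qed
qed

section \<open>Integration by parts away from the origin\<close>

text \<open>Translating \<open>F\<close> in direction \<open>b\<close> does not change its integral, so the difference quotients integrate to
zero, and they converge boundedly to the derivative. Differentiability is
asked for on a set \<open>S\<close> around the support only, which lets the weights below be singular at the origin.\<close>

lemma integral_directional_derivative_eq_0:
  fixes F :: "'a::euclidean_space \<Rightarrow> real"
  assumes "compact K" and "K \<subseteq> S"
    and deriv: "\<And>x. x \<in> S \<Longrightarrow> (F has_derivative F' x) (at x)"
    and cont: "continuous_on S (\<lambda>x. F' x b)"
    and zero: "\<And>x. x \<notin> K \<Longrightarrow> F x = 0"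
  shows "(LINT x:K|lborel. F' x b) = 0"
proof -
  define D where "D x = indicator K x * F' x b" for x
  \<comment> \<open>Outside \<open>K\<close> the function vanishes on an open set, hence so does its derivative.\<close>
  have der: "\<exists>G. (F has_derivative G) (at y) \<and> G b = D y" for y
  proof (cases "y \<in> K")
    case True
    then show ?thesis using deriv[of y] \<open>K \<subseteq> S\<close> by (auto simp: D_def)
  next
    case False
    have "open (- K)" using \<open>compact K\<close> compact_imp_closed by blast
    then have "(F has_derivative (\<lambda>_. 0)) (at y)"
      by (rule has_derivative_transform_within_open[OF has_derivative_const[of 0]])
        (use False zero in auto)
    then show ?thesis using False by (auto simp: D_def)
  qed
  have line: "((\<lambda>t. F (x + t *\<^sub>R b)) has_real_derivative D (x + t *\<^sub>R b)) (at t)" for x t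
  proof -
    obtain G where G: "(F has_derivative G) (at (x + t *\<^sub>R b))" "G b = D (x + t *\<^sub>R b)"
      using der by blast
    have "((\<lambda>t. x + t *\<^sub>R b) has_derivative (\<lambda>h. h *\<^sub>R b)) (at t)"
      by (auto intro!: derivative_eq_intros)
    from diff_chain_at[OF this G(1)] have "((\<lambda>t. F (x + t *\<^sub>R b)) has_derivative (\<lambda>h. G (h *\<^sub>R b))) (at t)"
      by (simp add: o_def)
    moreover have "G (h *\<^sub>R b) = D (x + t *\<^sub>R b) * h" for h
      using linear_cmul[OF has_derivative_linear[OF G(1)], of h b] G(2) by simp
    ultimately show ?thesis by (simp add: has_field_derivative_def)
  qed
  have contK: "continuous_on K (\<lambda>x. F' x b)" using cont \<open>K \<subseteq> S\<close> continuous_on_subset by blast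
  have intD: "integrable lborel D"
    using borel_integrable_compact[OF \<open>compact K\<close> contK] by (simp add: D_def[abs_def])
  have "continuous_on K F"
    using deriv \<open>K \<subseteq> S\<close> has_derivative_continuous
    by (metis continuous_at_imp_continuous_on subsetD)
  moreover have "(\<lambda>x. indicator K x *\<^sub>R F x) = F"
    by (auto simp: fun_eq_iff indicator_def zero)
  ultimately have intF: "integrable lborel F"
    using borel_integrable_compact[OF \<open>compact K\<close>, of F] by simp
  obtain M where M: "\<And>x. \<bar>D x\<bar> \<le> M"
  proof -
    have "bounded ((\<lambda>x. F' x b) ` K)"
      using compact_continuous_image[OF contK \<open>compact K\<close>] compact_imp_bounded by blast
    then obtain M where "\<forall>x\<in>K. \<bar>F' x b\<bar> \<le> M" by (auto simp: bounded_iff)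
    then have "\<bar>D x\<bar> \<le> max M 0" for x by (auto simp: D_def indicator_def)
    then show ?thesis using that by blast
  qed
  obtain R where R: "K \<subseteq> cball 0 R"
    using \<open>compact K\<close> compact_imp_bounded[of K] by (auto simp: bounded_iff subset_iff)
  define q where "q n x = (F (x + (1 / real (Suc n)) *\<^sub>R b) - F x) / (1 / real (Suc n))" for n x
  have qbd: "norm (q n x) \<le> M * indicator (cball 0 (R + norm b)) x" for n x
  proof (cases "x \<in> cball 0 (R + norm b)")
    case True
    define h where "h = 1 / real (Suc n)"
    have "h > 0" by (simp add: h_def)
    from MVT2[OF this line[of x]] obtain z where
      "F (x + h *\<^sub>R b) - F (x + 0 *\<^sub>R b) = (h - 0) * D (x + z *\<^sub>R b)" by blast
    then have "q n x = D (x + z *\<^sub>R b)" using \<open>h > 0\<close> unfolding q_def h_def[symmetric] by simp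
    then show ?thesis using True M by simp
  next
    case False
    have "norm ((1 / real (Suc n)) *\<^sub>R b) \<le> 1 * norm b"
      unfolding norm_scaleR by (rule mult_right_mono) auto
    then have "norm (x + (1 / real (Suc n)) *\<^sub>R b) > R"
      using False norm_triangle_ineq2[of x "- ((1 / real (Suc n)) *\<^sub>R b)"] by simp
    moreover have "norm x > R" using False norm_ge_zero[of b] by (simp del: norm_ge_zero)
    ultimately have "x \<notin> K" "x + (1 / real (Suc n)) *\<^sub>R b \<notin> K" using R by auto
    then have "q n x = 0" using zero by (simp add: q_def)
    then show ?thesis using False by simp
  qed
  have translate: "integrable lborel (\<lambda>x. F (x + c)) \<and> (\<integral>x. F (x + c) \<partial>lborel) = (\<integral>x. F x \<partial>lborel)" for c
  proof -
    have [measurable]: "F \<in> borel_measurable borel" using intF by auto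
    have "integrable (distr lborel borel ((+) c)) F \<longleftrightarrow> integrable lborel (\<lambda>x. F (c + x))"
      by (rule integrable_distr_eq) auto
    moreover have "(\<integral>x. F x \<partial>distr lborel borel ((+) c)) = (\<integral>x. F (c + x) \<partial>lborel)"
      by (rule integral_distr) auto
    ultimately show ?thesis using intF by (simp add: lborel_distr_plus add.commute)
  qed
  have q0: "(\<integral>x. q n x \<partial>lborel) = 0" for n
    unfolding q_def using translate[of "(1 / real (Suc n)) *\<^sub>R b"] intF by simp
  have lim: "(\<lambda>n. q n x) \<longlonglongrightarrow> D x" for x
  proof -
    have "((\<lambda>h. (F (x + h *\<^sub>R b) - F x) / h) \<longlongrightarrow> D x) (at 0)"
      using line[of x 0] by (simp add: has_field_derivative_iff)
    moreover have "filterlim (\<lambda>n. 1 / real (Suc n)) (at 0) sequentially"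
      using LIMSEQ_inverse_real_of_nat
      by (auto simp: filterlim_at inverse_eq_divide)
    ultimately show ?thesis unfolding q_def by (rule filterlim_compose)
  qed
  have "(\<lambda>n. \<integral>x. q n x \<partial>lborel) \<longlonglongrightarrow> (\<integral>x. D x \<partial>lborel)"
  proof (rule integral_dominated_convergence)
    show "integrable lborel (\<lambda>x::'a. M * indicator (cball 0 (R + norm b)) x)"
      using borel_integrable_compact[of "cball (0::'a) (R + norm b)" "\<lambda>_. M"]
      by (simp add: mult.commute)
    show "D \<in> borel_measurable lborel" using intD by auto
    show "q n \<in> borel_measurable lborel" for n
      using translate[of "(1 / real (Suc n)) *\<^sub>R b"] intF unfolding q_def[abs_def]
      by (intro borel_measurable_divide borel_measurable_diff borel_measurable_const borel_measurable_integrable) auto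
  qed (use qbd lim in auto)
  then have "(\<integral>x. D x \<partial>lborel) = 0" by (simp add: q0 LIMSEQ_const_iff)
  then show ?thesis by (simp add: D_def set_lebesgue_integral_def)
qed

lemma set_integrable_continuous_compact:
  fixes f :: "'a::euclidean_space \<Rightarrow> real"
  assumes "compact K" "continuous_on K f"
  shows "set_integrable lborel K f"
  using borel_integrable_compact[OF assms] by (simp add: set_integrable_def)

lemma integral_divergence_eq_0:
  fixes V :: "'a::euclidean_space \<Rightarrow> 'a \<Rightarrow> real"
  assumes "compact K" and "K \<subseteq> S"
    and "\<And>b x. b \<in> Basis \<Longrightarrow> x \<in> S \<Longrightarrow> (V b has_derivative V' b x) (at x)"
    and cont: "\<And>b. b \<in> Basis \<Longrightarrow> continuous_on S (\<lambda>x. V' b x b)"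
    and "\<And>b x. b \<in> Basis \<Longrightarrow> x \<notin> K \<Longrightarrow> V b x = 0"
  shows "(LINT x:K|lborel. (\<Sum>b\<in>Basis. V' b x b)) = 0"
proof -
  have "set_integrable lborel K (\<lambda>x. V' b x b)" if "b \<in> Basis" for b
    using set_integrable_continuous_compact[OF \<open>compact K\<close>] cont[OF that] \<open>K \<subseteq> S\<close>
      continuous_on_subset by blast
  then have "(LINT x:K|lborel. (\<Sum>b\<in>Basis. V' b x b)) = (\<Sum>b\<in>Basis. (LINT x:K|lborel. V' b x b))"
    unfolding set_lebesgue_integral_def set_integrable_def scaleR_sum_right
    by (rule Bochner_Integration.integral_sum)
  also have "\<dots> = 0"
    using integral_directional_derivative_eq_0[OF assms(1,2)] assms(3-5) by (intro sum.neutral) blast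
  finally show ?thesis .
qed

lemma has_derivative_norm_powr:
  fixes x :: "'a::euclidean_space"
  assumes "x \<noteq> 0"
  shows "((\<lambda>x. norm x powr a) has_derivative (\<lambda>h. a * norm x powr (a - 2) * (x \<bullet> h))) (at x)"
proof -
  have "((\<lambda>t. t powr a) has_derivative (*) (a * norm x powr (a - 1))) (at (norm x))"
    using has_real_derivative_powr[of "norm x" a] assms by (simp add: has_field_derivative_def)
  from diff_chain_at[OF has_derivative_norm[OF assms] this]
  have "((\<lambda>x. norm x powr a) has_derivative (\<lambda>h. a * norm x powr (a - 1) * (sgn x \<bullet> h))) (at x)"
    by (simp add: o_def inner_commute)
  moreover have "norm x powr (a - 1) * (sgn x \<bullet> h) = norm x powr (a - 2) * (x \<bullet> h)" for h
  proof -
    have "norm x powr (a - 1) = norm x powr (a - 2) * norm x"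
      using assms powr_add[of "norm x" "a - 2" 1] by simp
    then show ?thesis using assms by (simp add: sgn_div_norm)
  qed
  ultimately show ?thesis by (simp add: mult.assoc)
qed

lemma norm_powr_minus_2: "x \<noteq> 0 \<Longrightarrow> norm x powr (a - 2) * (norm x)\<^sup>2 = norm x powr a"
  using powr_add[of "norm x" "a - 2" 2] by simp

lemma continuous_on_norm_powr [continuous_intros]:
  "(\<And>x. x \<in> S \<Longrightarrow> x \<noteq> 0) \<Longrightarrow> continuous_on S (\<lambda>x::'a::euclidean_space. norm x powr a)"
  by (intro continuous_on_powr continuous_intros) auto

lemma has_derivative_zero_outside:
  fixes f :: "'a::euclidean_space \<Rightarrow> 'b::real_normed_vector"
  assumes "closed K" "\<And>x. x \<notin> K \<Longrightarrow> f x = 0" "x \<notin> K"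
  shows "(f has_derivative (\<lambda>_. 0)) (at x)"
  by (rule has_derivative_transform_within_open[OF has_derivative_const[of 0], of "- K"])
    (use assms in auto)

lemma continuous_on_UNIV_zero_outside:
  fixes f :: "'a::euclidean_space \<Rightarrow> 'b::real_normed_vector"
  assumes "closed K" "0 \<notin> K" "\<And>x. x \<notin> K \<Longrightarrow> f x = 0" "continuous_on (- {0}) f"
  shows "continuous_on UNIV f"
proof -
  have "continuous_on (- K) f"
    using assms(3) continuous_on_cong[of "- K" "- K" f "\<lambda>_. 0"] by auto
  then have "continuous_on (- K \<union> - {0}) f"
    using assms by (intro continuous_on_open_Un) auto
  moreover have "- K \<union> - {0} = UNIV" using assms(2) by auto
  ultimately show ?thesis by simp
qed

text \<open>The divergence theorem for the field \<open>h x \<bar>x\<bar> powr (- \<beta>)\<close>, where \<open>div (x \<bar>x\<bar> powr (- \<beta>)) = (d - \<beta>) \<bar>x\<bar> powr (- \<beta>)\<close>.\<close>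

lemma integral_radial_derivative:
  fixes h :: "'a::euclidean_space \<Rightarrow> real" and g :: "'a \<Rightarrow> 'a"
  assumes K: "compact K" "0 \<notin> K"
    and deriv: "\<And>x. (h has_derivative (\<lambda>v. g x \<bullet> v)) (at x)"
    and contg: "continuous_on UNIV g"
    and zero: "\<And>x. x \<notin> K \<Longrightarrow> h x = 0"
  shows "(LINT x:K|lborel. norm x powr (- \<beta>) * (x \<bullet> g x))
    = (\<beta> - real DIM('a)) * (LINT x:K|lborel. norm x powr (- \<beta>) * h x)"
proof -
  have KS: "K \<subseteq> - {0}" using K by auto
  have conth: "continuous_on A h" for A
    by (intro continuous_at_imp_continuous_on ballI has_derivative_continuous[OF deriv])
  have contg': "continuous_on A g" for A using contg continuous_on_subset by blast
  define V where "V b x = norm x powr (- \<beta>) * (x \<bullet> b) * h x" for b x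
  define V' where "V' b x v = norm x powr (- \<beta>) * (x \<bullet> b) * (g x \<bullet> v)
    + (norm x powr (- \<beta>) * (v \<bullet> b) + (- \<beta>) * norm x powr (- \<beta> - 2) * (x \<bullet> v) * (x \<bullet> b)) * h x" for b x v
  have "(LINT x:K|lborel. (\<Sum>b\<in>Basis. V' b x b)) = 0"
  proof (rule integral_divergence_eq_0[where V = V and V' = V', OF K(1) KS])
    fix b x :: 'a assume "x \<in> - {0}"
    then show "(V b has_derivative V' b x) (at x)"
      unfolding V_def[abs_def] V'_def[abs_def]
      by (intro has_derivative_mult has_derivative_norm_powr deriv has_derivative_inner_left
          has_derivative_ident) auto
  next
    fix b :: 'a
    show "continuous_on (- {0}) (\<lambda>x. V' b x b)"
      unfolding V'_def by (intro continuous_intros conth contg') auto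
  qed (simp add: V_def zero)
  moreover have "(\<Sum>b\<in>Basis. V' b x b) = norm x powr (- \<beta>) * (x \<bullet> g x)
      + (real DIM('a) - \<beta>) * (norm x powr (- \<beta>) * h x)" if "x \<in> K" for x
  proof -
    have "x \<noteq> 0" using that K by auto
    have "(\<Sum>b\<in>Basis. V' b x b) = norm x powr (- \<beta>) * (\<Sum>b\<in>Basis. (x \<bullet> b) * (g x \<bullet> b))
      + (norm x powr (- \<beta>) * (\<Sum>b\<in>Basis. (b::'a) \<bullet> b)
         - \<beta> * (norm x powr (- \<beta> - 2) * (\<Sum>b\<in>Basis. (x \<bullet> b) * (x \<bullet> b)))) * h x"
      unfolding V'_def by (simp add: sum.distrib sum_distrib_left sum_distrib_right algebra_simps sum_subtractf sum_negf)
    also have "\<dots> = norm x powr (- \<beta>) * (x \<bullet> g x)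
      + (norm x powr (- \<beta>) * real DIM('a) - \<beta> * (norm x powr (- \<beta> - 2) * (norm x)\<^sup>2)) * h x"
      by (simp add: euclidean_inner[symmetric] power2_norm_eq_inner)
    finally show ?thesis
      using norm_powr_minus_2[OF \<open>x \<noteq> 0\<close>, of "- \<beta>"] by (simp add: algebra_simps)
  qed
  ultimately have "(LINT x:K|lborel. norm x powr (- \<beta>) * (x \<bullet> g x)
      + (real DIM('a) - \<beta>) * (norm x powr (- \<beta>) * h x)) = 0"
    using K(1) by (subst (asm) set_lebesgue_integral_cong) (auto intro: borel_compact)
  moreover have i: "set_integrable lborel K (\<lambda>x. norm x powr (- \<beta>) * (x \<bullet> g x))"
      "set_integrable lborel K (\<lambda>x. (real DIM('a) - \<beta>) * (norm x powr (- \<beta>) * h x))"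
    using KS by (intro set_integrable_continuous_compact[OF K(1)] continuous_intros conth contg'; auto)+
  ultimately show ?thesis
    by (simp only: set_integral_add(2)[OF i] set_integral_mult_right) (simp add: algebra_simps)
qed

section \<open>Hardy's inequality for odd functions\<close>

lemma odd_poincare_weighted:
  fixes w :: "real^'n \<Rightarrow> real" and g :: "real^'n \<Rightarrow> real^'n"
  assumes K: "compact K" "0 \<notin> K"
    and deriv: "\<And>x. (w has_derivative (\<lambda>h. g x \<bullet> h)) (at x)"
    and contg: "continuous_on UNIV g"
    and zero: "\<And>x. x \<notin> K \<Longrightarrow> w x = 0" "\<And>x. x \<notin> K \<Longrightarrow> g x = 0"
    and odd: "\<And>x. w (- x) = - w x"
  shows "(real CARD('n) - 1) * (LINT x:K|lborel. (w x)\<^sup>2 / norm x ^ CARD('n))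
    \<le> (LINT x:K|lborel. (norm (g x))\<^sup>2 * (norm x)\<^sup>2 / norm x ^ CARD('n))"
proof -
  have conv: "(\<integral>\<^sup>+x. ennreal (f x) \<partial>lborel) = ennreal (LINT x:K|lborel. f x)"
    and nonneg: "0 \<le> (LINT x:K|lborel. f x)"
    if "continuous_on K f" "\<And>x. 0 \<le> f x" "\<And>x. x \<notin> K \<Longrightarrow> f x = 0" for f :: "real^'n \<Rightarrow> real"
  proof -
    have "(\<integral>\<^sup>+x. ennreal (f x) \<partial>lborel) = (\<integral>\<^sup>+x. ennreal (indicator K x *\<^sub>R f x) \<partial>lborel)"
      using that(3) by (intro nn_integral_cong) (auto simp: indicator_def)
    also have "\<dots> = ennreal (LINT x:K|lborel. f x)"
      unfolding set_lebesgue_integral_def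
      using that(2) by (intro nn_integral_eq_integral borel_integrable_compact[OF K(1) that(1)]) auto
    finally show "(\<integral>\<^sup>+x. ennreal (f x) \<partial>lborel) = ennreal (LINT x:K|lborel. f x)" .
    show "0 \<le> (LINT x:K|lborel. f x)"
      unfolding set_lebesgue_integral_def using that(2) by (intro integral_nonneg_AE) auto
  qed
  have contw: "continuous_on K w"
    by (intro continuous_at_imp_continuous_on ballI has_derivative_continuous[OF deriv])
  have contg': "continuous_on K g" using contg continuous_on_subset by blast
  have c1: "continuous_on K (\<lambda>x. (w x)\<^sup>2 / norm x ^ CARD('n))"
    using K by (intro continuous_intros contw) auto
  have c2: "continuous_on K (\<lambda>x. (norm (g x))\<^sup>2 * (norm x)\<^sup>2 / norm x ^ CARD('n))"
    using K by (intro continuous_intros contg') auto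
  have d: "0 \<le> real CARD('n) - 1"
    using zero_less_card_finite[where 'a = 'n] by simp
  have "ennreal ((real CARD('n) - 1) * (LINT x:K|lborel. (w x)\<^sup>2 / norm x ^ CARD('n)))
    = ennreal (real CARD('n) - 1) * ennreal (LINT x:K|lborel. (w x)\<^sup>2 / norm x ^ CARD('n))"
    by (intro ennreal_mult d nonneg c1) (simp_all add: zero)
  also have "\<dots> \<le> ennreal (LINT x:K|lborel. (norm (g x))\<^sup>2 * (norm x)\<^sup>2 / norm x ^ CARD('n))"
    using odd_poincare_weighted_nn[OF deriv contg odd]
    by (subst (asm) (1 2) conv) (simp_all add: c1 c2 zero)
  finally show ?thesis
    by (subst (asm) ennreal_le_iff) (intro nonneg c2; simp add: zero)
qed

text \<open>With \<open>m = (d - 2 - \<alpha>) / 2\<close> and \<open>w = \<bar>x\<bar> powr m * v\<close>, expanding \<open>\<bar>\<nabla>w\<bar>\<^sup>2\<close> and integrating the mixed term by parts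
gives \<open>\<integral> \<bar>\<nabla>w\<bar>\<^sup>2 \<bar>x\<bar>\<^sup>2\<^sup>-\<^sup>d = \<integral> \<bar>\<nabla>v\<bar>\<^sup>2 \<bar>x\<bar> powr (- \<alpha>) - m\<^sup>2 \<integral> v\<^sup>2 \<bar>x\<bar> powr (- \<alpha> - 2)\<close>. This accounts for the Hardy
constant \<open>m\<^sup>2\<close>, and the inequality for odd functions applied to \<open>w\<close> adds \<open>d - 1\<close>.\<close>

lemma odd_hardy:
  fixes v :: "real^'n \<Rightarrow> real" and g :: "real^'n \<Rightarrow> real^'n"
  assumes K: "compact K" "0 \<notin> K"
    and deriv: "\<And>x. (v has_derivative (\<lambda>h. g x \<bullet> h)) (at x)"
    and contg: "continuous_on UNIV g"
    and zero: "\<And>x. x \<notin> K \<Longrightarrow> v x = 0" "\<And>x. x \<notin> K \<Longrightarrow> g x = 0"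
    and odd: "\<And>x. v (- x) = - v x"
  shows "(((real CARD('n) - 2 - \<alpha>) / 2)\<^sup>2 + (real CARD('n) - 1)) * (LINT x:K|lborel. norm x powr (- \<alpha> - 2) * (v x)\<^sup>2)
    \<le> (LINT x:K|lborel. norm x powr (- \<alpha>) * (norm (g x))\<^sup>2)"
proof -
  define d where "d = real CARD('n)"
  define m where "m = (d - 2 - \<alpha>) / 2"
  define w where "w x = norm x powr m * v x" for x
  define gw where "gw x = norm x powr m *\<^sub>R g x + (m * norm x powr (m - 2) * v x) *\<^sub>R x" for x
  have closed: "closed K" using K compact_imp_closed by blast
  have contv: "continuous_on A v" for A
    by (intro continuous_at_imp_continuous_on ballI has_derivative_continuous[OF deriv])
  have contg': "continuous_on A g" for A using contg continuous_on_subset by blast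
  have K0: "x \<noteq> 0" if "x \<in> K" for x using that K by auto
  have derw: "(w has_derivative (\<lambda>h. gw x \<bullet> h)) (at x)" for x
  proof (cases "x \<in> K")
    case True
    have "(w has_derivative (\<lambda>h. norm x powr m * (g x \<bullet> h) + m * norm x powr (m - 2) * (x \<bullet> h) * v x)) (at x)"
      unfolding w_def[abs_def]
      by (intro has_derivative_mult has_derivative_norm_powr deriv K0[OF True])
    then show ?thesis by (simp add: gw_def inner_add_left algebra_simps)
  next
    case False
    have "(w has_derivative (\<lambda>_. 0)) (at x)"
      by (rule has_derivative_zero_outside[OF closed]) (simp_all add: w_def zero False)
    then show ?thesis by (simp add: gw_def zero False)
  qed
  have contgw: "continuous_on UNIV gw"
    unfolding gw_def
    by (rule continuous_on_UNIV_zero_outside[OF closed K(2)])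
      (auto simp: zero intro!: continuous_intros contv contg')
  have "(d - 1) * (LINT x:K|lborel. (w x)\<^sup>2 / norm x ^ CARD('n))
    \<le> (LINT x:K|lborel. (norm (gw x))\<^sup>2 * (norm x)\<^sup>2 / norm x ^ CARD('n))"
    unfolding d_def
    by (rule odd_poincare_weighted[OF K derw contgw]) (simp_all add: w_def gw_def zero odd)
  also have "(LINT x:K|lborel. (w x)\<^sup>2 / norm x ^ CARD('n)) = (LINT x:K|lborel. norm x powr (- \<alpha> - 2) * (v x)\<^sup>2)"
  proof (rule set_lebesgue_integral_cong)
    have "(norm x powr m)\<^sup>2 / norm x ^ CARD('n) = norm x powr (- \<alpha> - 2)" if "x \<noteq> 0" for x :: "real^'n"
    proof -
      have "(norm x powr m)\<^sup>2 = norm x powr (m + m)" by (simp only: powr_add power2_eq_square)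
      moreover have "norm x ^ CARD('n) = norm x powr d" using that by (simp add: d_def powr_realpow)
      moreover have "m + m - d = - \<alpha> - 2" by (simp add: m_def field_simps)
      ultimately show ?thesis using powr_diff[of "norm x" "m + m" d] by simp
    qed
    then show "\<forall>x. x \<in> K \<longrightarrow> (w x)\<^sup>2 / norm x ^ CARD('n) = norm x powr (- \<alpha> - 2) * (v x)\<^sup>2"
      using K0 by (simp add: w_def power_mult_distrib) (metis times_divide_eq_left)
  qed (use closed in simp)
  also have "(LINT x:K|lborel. (norm (gw x))\<^sup>2 * (norm x)\<^sup>2 / norm x ^ CARD('n))
    = (LINT x:K|lborel. norm x powr (- \<alpha>) * (norm (g x))\<^sup>2
        + (m * (norm x powr (- (\<alpha> + 2)) * (x \<bullet> ((2 * v x) *\<^sub>R g x))) + m\<^sup>2 * (norm x powr (- (\<alpha> + 2)) * (v x)\<^sup>2)))"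
  proof (rule set_lebesgue_integral_cong)
    show "\<forall>x. x \<in> K \<longrightarrow> (norm (gw x))\<^sup>2 * (norm x)\<^sup>2 / norm x ^ CARD('n) = norm x powr (- \<alpha>) * (norm (g x))\<^sup>2
        + (m * (norm x powr (- (\<alpha> + 2)) * (x \<bullet> ((2 * v x) *\<^sub>R g x))) + m\<^sup>2 * (norm x powr (- (\<alpha> + 2)) * (v x)\<^sup>2))"
    proof (intro allI impI)
      fix x assume "x \<in> K"
      then have x: "x \<noteq> 0" by (rule K0)
      define q where "q = norm x powr (m - 2)"
      define N where "N = norm x"
      have N: "N > 0" using x by (simp add: N_def)
      have m: "norm x powr m = q * N\<^sup>2" using norm_powr_minus_2[OF x, of m] by (simp add: q_def N_def)
      have nn: "(norm (gw x))\<^sup>2 = q\<^sup>2 * (N ^ 4 * (norm (g x))\<^sup>2 + 2 * m * N\<^sup>2 * v x * (x \<bullet> g x) + m\<^sup>2 * (v x)\<^sup>2 * N\<^sup>2)"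
      proof -
        have "gw x = q *\<^sub>R (N\<^sup>2 *\<^sub>R g x + (m * v x) *\<^sub>R x)"
          unfolding gw_def m q_def[symmetric] by (simp add: algebra_simps)
        then have "(norm (gw x))\<^sup>2 = q\<^sup>2 * (norm (N\<^sup>2 *\<^sub>R g x + (m * v x) *\<^sub>R x))\<^sup>2"
          by (simp add: power_mult_distrib)
        also have "(norm (N\<^sup>2 *\<^sub>R g x + (m * v x) *\<^sub>R x))\<^sup>2
          = N ^ 4 * (norm (g x))\<^sup>2 + 2 * m * N\<^sup>2 * v x * (x \<bullet> g x) + m\<^sup>2 * (v x)\<^sup>2 * N\<^sup>2"
        proof -
          have "(norm (a *\<^sub>R g x + c *\<^sub>R x))\<^sup>2 = a\<^sup>2 * (norm (g x))\<^sup>2 + 2 * a * c * (x \<bullet> g x) + c\<^sup>2 * (norm x)\<^sup>2" for a c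
            unfolding power2_norm_eq_inner
            by (simp add: inner_add_left inner_add_right inner_commute[of "g x" x] power2_eq_square algebra_simps)
          from this[of "N\<^sup>2" "m * v x"] show ?thesis
            by (simp add: N_def[symmetric] power_mult_distrib)
        qed
        finally show ?thesis .
      qed
      have e1: "q\<^sup>2 * N ^ 4 * N\<^sup>2 / N ^ CARD('n) = norm x powr (- \<alpha>)"
        and e2: "q\<^sup>2 * N\<^sup>2 * N\<^sup>2 / N ^ CARD('n) = norm x powr (- (\<alpha> + 2))"
      proof -
        have p: "N ^ k = N powr real k" for k using N by (simp add: powr_realpow)
        have q2: "q\<^sup>2 = N powr (m - 2 + (m - 2))" by (simp only: q_def N_def powr_add power2_eq_square)
        show "q\<^sup>2 * N ^ 4 * N\<^sup>2 / N ^ CARD('n) = norm x powr (- \<alpha>)"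
          unfolding q2 p N_def[symmetric] powr_add[symmetric] powr_diff[symmetric]
          by (simp add: m_def d_def)
        show "q\<^sup>2 * N\<^sup>2 * N\<^sup>2 / N ^ CARD('n) = norm x powr (- (\<alpha> + 2))"
          unfolding q2 p N_def[symmetric] powr_add[symmetric] powr_diff[symmetric]
          by (simp add: m_def d_def)
      qed
      have "(norm (gw x))\<^sup>2 * (norm x)\<^sup>2 / norm x ^ CARD('n)
        = (q\<^sup>2 * N ^ 4 * N\<^sup>2 / N ^ CARD('n)) * (norm (g x))\<^sup>2
          + (m * ((q\<^sup>2 * N\<^sup>2 * N\<^sup>2 / N ^ CARD('n)) * (x \<bullet> ((2 * v x) *\<^sub>R g x)))
          + m\<^sup>2 * ((q\<^sup>2 * N\<^sup>2 * N\<^sup>2 / N ^ CARD('n)) * (v x)\<^sup>2))"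
        unfolding nn N_def[symmetric] by (simp add: add_divide_distrib algebra_simps)
      then show "(norm (gw x))\<^sup>2 * (norm x)\<^sup>2 / norm x ^ CARD('n) = norm x powr (- \<alpha>) * (norm (g x))\<^sup>2
        + (m * (norm x powr (- (\<alpha> + 2)) * (x \<bullet> ((2 * v x) *\<^sub>R g x))) + m\<^sup>2 * (norm x powr (- (\<alpha> + 2)) * (v x)\<^sup>2))"
        unfolding e1 e2 .
    qed
  qed (use closed in simp)
  also have "\<dots> = (LINT x:K|lborel. norm x powr (- \<alpha>) * (norm (g x))\<^sup>2)
     + (m * (LINT x:K|lborel. norm x powr (- (\<alpha> + 2)) * (x \<bullet> ((2 * v x) *\<^sub>R g x)))
     + m\<^sup>2 * (LINT x:K|lborel. norm x powr (- (\<alpha> + 2)) * (v x)\<^sup>2))"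
  proof -
    have i: "set_integrable lborel K (\<lambda>x. norm x powr (- \<alpha>) * (norm (g x))\<^sup>2)"
      "set_integrable lborel K (\<lambda>x. m * (norm x powr (- (\<alpha> + 2)) * (x \<bullet> ((2 * v x) *\<^sub>R g x))))"
      "set_integrable lborel K (\<lambda>x. m\<^sup>2 * (norm x powr (- (\<alpha> + 2)) * (v x)\<^sup>2))"
      by (intro set_integrable_continuous_compact[OF K(1)] continuous_intros contv contg' K0; simp)+
    show ?thesis
      by (simp only: set_integral_add(2)[OF i(1) set_integral_add(1)[OF i(2,3)]]
          set_integral_add(2)[OF i(2,3)] set_integral_mult_right)
  qed
  also have "(LINT x:K|lborel. norm x powr (- (\<alpha> + 2)) * (x \<bullet> ((2 * v x) *\<^sub>R g x)))
    = (\<alpha> + 2 - d) * (LINT x:K|lborel. norm x powr (- (\<alpha> + 2)) * (v x)\<^sup>2)"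
  proof -
    have "((\<lambda>x. (v x)\<^sup>2) has_derivative (\<lambda>h. ((2 * v x) *\<^sub>R g x) \<bullet> h)) (at x)" for x
      using has_derivative_power[OF deriv[of x], of 2] by (simp add: algebra_simps)
    moreover have "continuous_on UNIV (\<lambda>x. (2 * v x) *\<^sub>R g x)"
      by (intro continuous_intros contv contg')
    ultimately show ?thesis
      using integral_radial_derivative[OF K, of "\<lambda>x. (v x)\<^sup>2" "\<lambda>x. (2 * v x) *\<^sub>R g x" "\<alpha> + 2"]
      by (simp add: zero d_def)
  qed
  also have "\<alpha> + 2 - d = - 2 * m" by (simp add: m_def)
  finally have "(d - 1) * (LINT x:K|lborel. norm x powr (- \<alpha> - 2) * (v x)\<^sup>2)
     \<le> (LINT x:K|lborel. norm x powr (- \<alpha>) * (norm (g x))\<^sup>2)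
       - m\<^sup>2 * (LINT x:K|lborel. norm x powr (- \<alpha> - 2) * (v x)\<^sup>2)"
    by (simp add: power2_eq_square algebra_simps)
  then show ?thesis unfolding d_def[symmetric] m_def[symmetric] by (simp add: algebra_simps)
qed

section \<open>Testing the Laplacian with a power of the function\<close>

text \<open>A function of compact support away from the origin vanishes near the origin and is therefore as
smooth there as elsewhere, so that the origin needs no separate treatment in what follows.\<close>

lemma C2c_gradient:
  fixes u :: "'a::euclidean_space \<Rightarrow> real"
  assumes "u \<in> C2c (- {0})"
  obtains K g H where "compact K" "0 \<notin> K"
    "\<And>x. (u has_derivative (\<lambda>h. g x \<bullet> h)) (at x)" "continuous_on UNIV g"
    "\<And>b x. b \<in> Basis \<Longrightarrow> ((\<lambda>y. g y \<bullet> b) has_derivative H b x) (at x)"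
    "\<And>b. b \<in> Basis \<Longrightarrow> continuous_on UNIV (\<lambda>x. H b x b)"
    "\<And>x. laplacian u x = (\<Sum>b\<in>Basis. H b x b)"
    "\<And>x. x \<notin> K \<Longrightarrow> u x = 0" "\<And>x. x \<notin> K \<Longrightarrow> g x = 0" "\<And>x. x \<notin> K \<Longrightarrow> laplacian u x = 0"
proof -
  define K where "K = closure (support_on UNIV u)"
  define g where "g x = (\<Sum>b\<in>Basis. frechet_derivative u (at x) b *\<^sub>R b)" for x
  define H where "H b x = frechet_derivative (\<lambda>y. frechet_derivative u (at y) b) (at x)" for b x
  have K: "compact K" "0 \<notin> K" using assms by (auto simp: C2c_def K_def)
  have closed: "closed K" by (simp add: K_def)
  have u0: "u x = 0" if "x \<notin> K" for x
  proof (rule ccontr)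
    assume "u x \<noteq> 0"
    then have "x \<in> support_on UNIV u" by (simp add: support_on_def)
    then show False using that closure_subset unfolding K_def by blast
  qed
  have C1: "C1_on (- {0}) u" and C1': "C1_on (- {0}) (\<lambda>x. frechet_derivative u (at x) v)" for v
    using assms by (auto simp: C2c_def C2_on_def)
  have fd: "(u has_derivative frechet_derivative u (at x)) (at x)" for x
  proof (cases "x \<in> K")
    case True
    then have "x \<noteq> 0" using K by auto
    then have "u differentiable at x" using C1 by (simp add: C1_on_def)
    then show ?thesis by (rule frechet_derivative_works[THEN iffD1])
  next
    case False
    have "(u has_derivative (\<lambda>_. 0)) (at x)"
      by (rule has_derivative_zero_outside[OF closed u0 False])
    then show ?thesis by (rule frechet_derivative_works[THEN iffD1, OF differentiableI])
  qed
  have fd0: "frechet_derivative u (at x) v = 0" if "x \<notin> K" for x v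
    by (simp add: frechet_derivative_at[OF has_derivative_zero_outside[OF closed u0 that], symmetric])
  have gi: "g x \<bullet> h = frechet_derivative u (at x) h" for x h
  proof -
    interpret l: linear "frechet_derivative u (at x)"
      using has_derivative_linear[OF fd] .
    have "frechet_derivative u (at x) h = frechet_derivative u (at x) (\<Sum>b\<in>Basis. (h \<bullet> b) *\<^sub>R b)"
      by (simp add: euclidean_representation)
    also have "\<dots> = (\<Sum>b\<in>Basis. (h \<bullet> b) * frechet_derivative u (at x) b)"
      by (simp add: l.sum l.scale)
    finally show ?thesis
      unfolding g_def inner_sum_left by (simp add: mult.commute inner_commute[of h])
  qed
  have g0: "g x = 0" if "x \<notin> K" for x using fd0[OF that] by (simp add: g_def)
  have Hd: "((\<lambda>y. frechet_derivative u (at y) b) has_derivative H b x) (at x)" for b x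
  proof (cases "x \<in> K")
    case True
    then have "x \<noteq> 0" using K by auto
    then have "(\<lambda>y. frechet_derivative u (at y) b) differentiable at x"
      using C1'[of b] by (simp add: C1_on_def)
    then show ?thesis unfolding H_def by (rule frechet_derivative_works[THEN iffD1])
  next
    case False
    have "((\<lambda>y. frechet_derivative u (at y) b) has_derivative (\<lambda>_. 0)) (at x)"
      by (rule has_derivative_zero_outside[OF closed fd0 False])
    then show ?thesis unfolding H_def by (rule frechet_derivative_works[THEN iffD1, OF differentiableI])
  qed
  have H0: "H b x v = 0" if "x \<notin> K" for b x v
    by (simp add: H_def frechet_derivative_at[OF has_derivative_zero_outside[OF closed fd0 that], symmetric])
  have cg: "continuous_on UNIV g"
  proof (rule continuous_on_UNIV_zero_outside[OF closed K(2) g0])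
    show "continuous_on (- {0}) g"
      unfolding g_def using C1 by (intro continuous_intros) (auto simp: C1_on_def)
  qed
  have cH: "continuous_on UNIV (\<lambda>x. H b x b)" for b
  proof (rule continuous_on_UNIV_zero_outside[OF closed K(2) H0])
    show "continuous_on (- {0}) (\<lambda>x. H b x b)"
      using C1'[of b] by (simp add: H_def C1_on_def)
  qed
  have lap: "laplacian u x = (\<Sum>b\<in>Basis. H b x b)" for x
    by (simp add: laplacian_def H_def)
  show ?thesis
    by (rule that[of K g H]) (use K fd Hd cg cH lap u0 g0 H0 gi in \<open>simp_all\<close>)
qed

text \<open>The divergence theorem for \<open>\<phi>(u) \<bar>x\<bar> powr (- \<alpha>) \<nabla>u\<close>. The term in which the weight is differentiated is the
radial derivative of \<open>\<Phi>(u)\<close>, which is integrated by parts once more.\<close>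

lemma integral_laplacian_by_parts:
  fixes u :: "'a::euclidean_space \<Rightarrow> real"
  assumes K: "compact K" "0 \<notin> K"
    and deriv: "\<And>x. (u has_derivative (\<lambda>h. g x \<bullet> h)) (at x)"
    and contg: "continuous_on UNIV g"
    and deriv2: "\<And>b x. b \<in> Basis \<Longrightarrow> ((\<lambda>y. g y \<bullet> b) has_derivative H b x) (at x)"
    and contH: "\<And>b. b \<in> Basis \<Longrightarrow> continuous_on UNIV (\<lambda>x. H b x b)"
    and zero: "\<And>x. x \<notin> K \<Longrightarrow> u x = 0" "\<And>x. x \<notin> K \<Longrightarrow> g x = 0"
    and \<Phi>: "\<And>s. (\<Phi> has_real_derivative \<phi> s) (at s)" "\<Phi> 0 = 0"
    and \<phi>: "\<And>s. (\<phi> has_real_derivative \<phi>' s) (at s)" "continuous_on UNIV \<phi>'"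
  shows "- (LINT x:K|lborel. norm x powr (- \<alpha>) * (\<phi> (u x) * (\<Sum>b\<in>Basis. H b x b)))
    = (LINT x:K|lborel. norm x powr (- \<alpha>) * (\<phi>' (u x) * (norm (g x))\<^sup>2))
      + \<alpha> * (real DIM('a) - 2 - \<alpha>) * (LINT x:K|lborel. norm x powr (- \<alpha> - 2) * \<Phi> (u x))"
proof -
  have closed: "closed K" using K compact_imp_closed by blast
  have K0: "x \<noteq> 0" if "x \<in> K" for x using that K by auto
  have contu: "continuous_on A u" for A
    by (intro continuous_at_imp_continuous_on ballI has_derivative_continuous[OF deriv])
  have contg': "continuous_on A g" for A using contg continuous_on_subset by blast
  have contH': "continuous_on A (\<lambda>x. H b x b)" if "b \<in> Basis" for A b
    using contH[OF that] continuous_on_subset by blast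
  have cp: "continuous_on A (\<lambda>x. \<phi> (u x))" for A
    by (rule continuous_on_compose2[OF _ contu, of UNIV])
      (auto intro: continuous_at_imp_continuous_on DERIV_isCont \<phi>(1))
  have cp': "continuous_on A (\<lambda>x. \<phi>' (u x))" for A
    by (rule continuous_on_compose2[OF \<phi>(2) contu]) auto
  have cP: "continuous_on A (\<lambda>x. \<Phi> (u x))" for A
    by (rule continuous_on_compose2[OF _ contu, of UNIV])
      (auto intro: continuous_at_imp_continuous_on DERIV_isCont \<Phi>(1))
  have chain: "((\<lambda>x. f (u x)) has_derivative (\<lambda>h. f' (u x) * (g x \<bullet> h))) (at x)"
    if "\<And>s. (f has_real_derivative f' s) (at s)" for f f' x
    using diff_chain_at[OF deriv that[unfolded has_field_derivative_def]] by (simp add: o_def)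
  define V where "V b x = norm x powr (- \<alpha>) * \<phi> (u x) * (g x \<bullet> b)" for b x
  define V' where "V' b x v = norm x powr (- \<alpha>) * \<phi> (u x) * H b x v
    + (norm x powr (- \<alpha>) * (\<phi>' (u x) * (g x \<bullet> v)) + (- \<alpha>) * norm x powr (- \<alpha> - 2) * (x \<bullet> v) * \<phi> (u x)) * (g x \<bullet> b)"
    for b x v
  have "(LINT x:K|lborel. (\<Sum>b\<in>Basis. V' b x b)) = 0"
  proof (rule integral_divergence_eq_0[where V = V and V' = V', OF K(1)])
    show "K \<subseteq> - {0}" using K0 by auto
  next
    fix b x :: 'a assume "b \<in> Basis" "x \<in> - {0}"
    then show "(V b has_derivative V' b x) (at x)"
      unfolding V_def[abs_def] V'_def[abs_def]
      by (intro has_derivative_mult has_derivative_norm_powr deriv2 chain \<phi>(1)) auto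
  next
    fix b :: 'a assume "b \<in> Basis"
    then show "continuous_on (- {0}) (\<lambda>x. V' b x b)"
      unfolding V'_def by (intro continuous_intros contg' contH' cp cp') auto
  qed (simp add: V_def zero)
  also have "(LINT x:K|lborel. (\<Sum>b\<in>Basis. V' b x b))
    = (LINT x:K|lborel. norm x powr (- \<alpha>) * (\<phi> (u x) * (\<Sum>b\<in>Basis. H b x b))
        + (norm x powr (- \<alpha>) * (\<phi>' (u x) * (norm (g x))\<^sup>2)
        - \<alpha> * (norm x powr (- (\<alpha> + 2)) * (x \<bullet> (\<phi> (u x) *\<^sub>R g x)))))"
  proof (rule set_lebesgue_integral_cong)
    show "\<forall>x. x \<in> K \<longrightarrow> (\<Sum>b\<in>Basis. V' b x b) = norm x powr (- \<alpha>) * (\<phi> (u x) * (\<Sum>b\<in>Basis. H b x b))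
        + (norm x powr (- \<alpha>) * (\<phi>' (u x) * (norm (g x))\<^sup>2)
        - \<alpha> * (norm x powr (- (\<alpha> + 2)) * (x \<bullet> (\<phi> (u x) *\<^sub>R g x))))"
    proof (intro allI impI)
      fix x
      have "(\<Sum>b\<in>Basis. V' b x b) = norm x powr (- \<alpha>) * \<phi> (u x) * (\<Sum>b\<in>Basis. H b x b)
        + (norm x powr (- \<alpha>) * \<phi>' (u x) * (\<Sum>b\<in>Basis. (g x \<bullet> b) * (g x \<bullet> b))
        - \<alpha> * norm x powr (- \<alpha> - 2) * \<phi> (u x) * (\<Sum>b\<in>Basis. (x \<bullet> b) * (g x \<bullet> b)))"
        unfolding V'_def
        by (simp add: sum.distrib sum_distrib_left sum_subtractf sum_negf algebra_simps)
      then show "(\<Sum>b\<in>Basis. V' b x b) = norm x powr (- \<alpha>) * (\<phi> (u x) * (\<Sum>b\<in>Basis. H b x b))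
        + (norm x powr (- \<alpha>) * (\<phi>' (u x) * (norm (g x))\<^sup>2)
        - \<alpha> * (norm x powr (- (\<alpha> + 2)) * (x \<bullet> (\<phi> (u x) *\<^sub>R g x))))"
        by (simp add: euclidean_inner[symmetric] power2_norm_eq_inner)
    qed
  qed (use closed in simp)
  also have "\<dots> = (LINT x:K|lborel. norm x powr (- \<alpha>) * (\<phi> (u x) * (\<Sum>b\<in>Basis. H b x b)))
        + ((LINT x:K|lborel. norm x powr (- \<alpha>) * (\<phi>' (u x) * (norm (g x))\<^sup>2))
        - \<alpha> * (LINT x:K|lborel. norm x powr (- (\<alpha> + 2)) * (x \<bullet> (\<phi> (u x) *\<^sub>R g x))))"
  proof -
    have i: "set_integrable lborel K (\<lambda>x. norm x powr (- \<alpha>) * (\<phi> (u x) * (\<Sum>b\<in>Basis. H b x b)))"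
      "set_integrable lborel K (\<lambda>x. norm x powr (- \<alpha>) * (\<phi>' (u x) * (norm (g x))\<^sup>2))"
      "set_integrable lborel K (\<lambda>x. \<alpha> * (norm x powr (- (\<alpha> + 2)) * (x \<bullet> (\<phi> (u x) *\<^sub>R g x))))"
      by (intro set_integrable_continuous_compact[OF K(1)] continuous_intros contg' contH' cp cp' K0; simp)+
    show ?thesis
      by (simp only: set_integral_add(2)[OF i(1) set_integral_diff(1)[OF i(2,3)]]
          set_integral_diff(2)[OF i(2,3)] set_integral_mult_right)
  qed
  also have "(LINT x:K|lborel. norm x powr (- (\<alpha> + 2)) * (x \<bullet> (\<phi> (u x) *\<^sub>R g x)))
     = (\<alpha> + 2 - real DIM('a)) * (LINT x:K|lborel. norm x powr (- (\<alpha> + 2)) * \<Phi> (u x))"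
  proof -
    have "((\<lambda>x. \<Phi> (u x)) has_derivative (\<lambda>h. (\<phi> (u x) *\<^sub>R g x) \<bullet> h)) (at x)" for x
      using chain[OF \<Phi>(1)] by simp
    moreover have "continuous_on UNIV (\<lambda>x. \<phi> (u x) *\<^sub>R g x)"
      by (intro continuous_intros cp contg')
    ultimately show ?thesis
      using integral_radial_derivative[OF K, of "\<lambda>x. \<Phi> (u x)" "\<lambda>x. \<phi> (u x) *\<^sub>R g x" "\<alpha> + 2"]
      by (simp add: zero \<Phi>(2))
  qed
  finally show ?thesis by (simp add: algebra_simps)
qed

text \<open>The regularisations \<open>\<Phi>\<close>, \<open>\<phi>\<close>, \<open>\<psi>\<close> of \<open>\<bar>s\<bar>\<^sup>p / p\<close>, \<open>\<bar>s\<bar> powr (p - 2) * s\<close> and \<open>\<bar>s\<bar> powr (p / 2 - 1) * s\<close>. Without regularisation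
\<open>\<phi>' = 4 (p - 1) / p\<^sup>2 * \<psi>'\<^sup>2\<close>, which turns the energy of \<open>u\<close> into that of \<open>\<psi>(u)\<close>. With it the last assertion
remains: after cancelling a power of \<open>s\<^sup>2 + e\<close> the two polynomials in \<open>s\<^sup>2\<close> have the same leading
coefficient, and the others compare because \<open>4 (p - 1) \<le> p\<^sup>2\<close>.\<close>

lemma regularised_power_derivs:
  fixes p e s :: real
  assumes "e > 0" "p > 1"
  shows "((\<lambda>s. ((s\<^sup>2 + e) powr (p / 2) - e powr (p / 2)) / p) has_real_derivative s * (s\<^sup>2 + e) powr (p / 2 - 1)) (at s)"
    and "((\<lambda>s. s * (s\<^sup>2 + e) powr (p / 2 - 1)) has_real_derivative
          (s\<^sup>2 + e) powr (p / 2 - 2) * ((p - 1) * s\<^sup>2 + e)) (at s)"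
    and "((\<lambda>s. s * (s\<^sup>2 + e) powr (p / 4 - 1 / 2)) has_real_derivative
          (s\<^sup>2 + e) powr (p / 4 - 3 / 2) * (p / 2 * s\<^sup>2 + e)) (at s)"
    and "4 * (p - 1) / p\<^sup>2 * ((s\<^sup>2 + e) powr (p / 4 - 3 / 2) * (p / 2 * s\<^sup>2 + e))\<^sup>2
      \<le> (s\<^sup>2 + e) powr (p / 2 - 2) * ((p - 1) * s\<^sup>2 + e)"
proof -
  define r where "r = s\<^sup>2 + e"
  have r: "r > 0" using assms by (simp add: r_def add_nonneg_pos)
  have dpow: "((\<lambda>s. (s\<^sup>2 + e) powr a) has_real_derivative a * r powr (a - 1) * (2 * s)) (at s)" for a
    using r unfolding r_def by (auto intro!: derivative_eq_intros)
  show "((\<lambda>s. ((s\<^sup>2 + e) powr (p / 2) - e powr (p / 2)) / p) has_real_derivative s * (s\<^sup>2 + e) powr (p / 2 - 1)) (at s)"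
    using DERIV_cdivide[OF DERIV_diff[OF dpow DERIV_const], of "p / 2" "e powr (p / 2)" p] assms
    by (simp add: r_def mult.commute)
  have mul: "((\<lambda>s. s * (s\<^sup>2 + e) powr a) has_real_derivative r powr (a - 1) * ((1 + 2 * a) * s\<^sup>2 + e)) (at s)" for a
  proof -
    have "r powr a = r powr (a - 1) * r" using r powr_add[of r "a - 1" 1] by simp
    then show ?thesis
      using DERIV_mult[OF DERIV_ident dpow[of a]]
      by (simp add: r_def power2_eq_square algebra_simps)
  qed
  show "((\<lambda>s. s * (s\<^sup>2 + e) powr (p / 2 - 1)) has_real_derivative
          (s\<^sup>2 + e) powr (p / 2 - 2) * ((p - 1) * s\<^sup>2 + e)) (at s)"
    using mul[of "p / 2 - 1"] by (simp add: r_def)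
  show "((\<lambda>s. s * (s\<^sup>2 + e) powr (p / 4 - 1 / 2)) has_real_derivative
          (s\<^sup>2 + e) powr (p / 4 - 3 / 2) * (p / 2 * s\<^sup>2 + e)) (at s)"
    using mul[of "p / 4 - 1 / 2"] by (simp add: r_def)
  define S where "S = s\<^sup>2"
  have S: "S \<ge> 0" by (simp add: S_def)
  have c1: "4 * (p - 1) \<le> p\<^sup>2"
    using zero_le_power2[of "p - 2"] by (simp add: power2_eq_square algebra_simps)
  have "4 * (p - 1) * (p / 2 * S + e)\<^sup>2 = p\<^sup>2 * ((p - 1) * S\<^sup>2) + 4 * (p - 1) * (p * (S * e) + e\<^sup>2)"
    by (simp add: power2_eq_square field_simps)
  also have "\<dots> \<le> p\<^sup>2 * ((p - 1) * S\<^sup>2) + p\<^sup>2 * (p * (S * e) + e\<^sup>2)"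
    using assms S by (intro add_left_mono mult_right_mono c1) auto
  also have "\<dots> = p\<^sup>2 * ((S + e) * ((p - 1) * S + e))"
    by (simp add: power2_eq_square algebra_simps)
  finally have poly: "4 * (p - 1) / p\<^sup>2 * (p / 2 * S + e)\<^sup>2 \<le> (S + e) * ((p - 1) * S + e)"
    using assms by (simp add: divide_simps mult.commute)
  have "(r powr (p / 4 - 3 / 2))\<^sup>2 = r powr (p / 2 - 3)"
    by (simp add: power2_eq_square powr_add[symmetric])
  moreover have "r powr (p / 2 - 2) = r powr (p / 2 - 3) * r"
    using r powr_add[of r "p / 2 - 3" 1] by simp
  moreover have "r powr (p / 2 - 3) * (4 * (p - 1) / p\<^sup>2 * (p / 2 * S + e)\<^sup>2)
     \<le> r powr (p / 2 - 3) * (r * ((p - 1) * S + e))"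
    using poly unfolding r_def S_def by (intro mult_left_mono) auto
  ultimately have "4 * (p - 1) / p\<^sup>2 * (r powr (p / 4 - 3 / 2) * (p / 2 * S + e))\<^sup>2
      \<le> r powr (p / 2 - 2) * ((p - 1) * S + e)"
    by (simp only: power_mult_distrib ac_simps)
  then show "4 * (p - 1) / p\<^sup>2 * ((s\<^sup>2 + e) powr (p / 4 - 3 / 2) * (p / 2 * s\<^sup>2 + e))\<^sup>2
      \<le> (s\<^sup>2 + e) powr (p / 2 - 2) * ((p - 1) * s\<^sup>2 + e)"
    by (simp only: r_def S_def)
qed

lemma regularised_power_bounds:
  fixes p e s M :: real
  assumes "p > 1" "0 < e" "e \<le> 1" "\<bar>s\<bar> \<le> M"
  shows "\<bar>(s * (s\<^sup>2 + e) powr (p / 4 - 1 / 2))\<^sup>2\<bar> \<le> (M\<^sup>2 + 1) powr (p / 2)"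
    and "\<bar>\<bar>s * (s\<^sup>2 + e) powr (p / 2 - 1)\<bar>\<bar> \<le> (M\<^sup>2 + 1) powr ((p - 1) / 2)"
    and "\<bar>((s\<^sup>2 + e) powr (p / 2) - e powr (p / 2)) / p\<bar> \<le> (M\<^sup>2 + 1) powr (p / 2) / p"
proof -
  define r where "r = s\<^sup>2 + e"
  have r: "r > 0" using assms by (simp add: r_def add_nonneg_pos)
  have rM: "r \<le> M\<^sup>2 + 1"
    using assms power_mono[of "\<bar>s\<bar>" M 2] by (simp add: r_def)
  have mono: "r powr a \<le> (M\<^sup>2 + 1) powr a" if "a \<ge> 0" for a
    using that r rM by (intro powr_mono2) auto
  have "(s * r powr (p / 4 - 1 / 2))\<^sup>2 = s\<^sup>2 * r powr (p / 2 - 1)"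
    by (simp add: power_mult_distrib power2_eq_square powr_add[symmetric])
  also have "\<dots> \<le> r * r powr (p / 2 - 1)"
    using assms by (intro mult_right_mono) (auto simp: r_def)
  also have "\<dots> = r powr (p / 2)" using r powr_add[of r 1 "p / 2 - 1"] by simp
  also have "\<dots> \<le> (M\<^sup>2 + 1) powr (p / 2)" using assms by (intro mono) simp
  finally show "\<bar>(s * (s\<^sup>2 + e) powr (p / 4 - 1 / 2))\<^sup>2\<bar> \<le> (M\<^sup>2 + 1) powr (p / 2)"
    by (simp add: r_def)
  have "\<bar>s * r powr (p / 2 - 1)\<bar> = sqrt (s\<^sup>2) * r powr (p / 2 - 1)" by (simp add: abs_mult)
  also have "\<dots> \<le> sqrt r * r powr (p / 2 - 1)"
    using assms by (intro mult_right_mono real_sqrt_le_mono) (auto simp: r_def)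
  also have "\<dots> = r powr ((p - 1) / 2)"
    using r powr_add[of r "1 / 2" "p / 2 - 1"] by (simp add: powr_half_sqrt diff_divide_distrib)
  also have "\<dots> \<le> (M\<^sup>2 + 1) powr ((p - 1) / 2)" using assms by (intro mono) simp
  finally show "\<bar>\<bar>s * (s\<^sup>2 + e) powr (p / 2 - 1)\<bar>\<bar> \<le> (M\<^sup>2 + 1) powr ((p - 1) / 2)"
    by (simp add: r_def)
  have "e powr (p / 2) \<le> r powr (p / 2)" using assms by (intro powr_mono2) (auto simp: r_def)
  then have "\<bar>r powr (p / 2) - e powr (p / 2)\<bar> \<le> r powr (p / 2)" by simp
  also have "\<dots> \<le> (M\<^sup>2 + 1) powr (p / 2)" using assms by (intro mono) simp
  finally show "\<bar>((s\<^sup>2 + e) powr (p / 2) - e powr (p / 2)) / p\<bar> \<le> (M\<^sup>2 + 1) powr (p / 2) / p"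
    using assms by (simp add: r_def divide_right_mono)
qed

lemma regularised_power_tendsto:
  fixes p s :: real
  assumes "p > 1"
  shows "((\<lambda>e. (s * (s\<^sup>2 + e) powr (p / 4 - 1 / 2))\<^sup>2) \<longlongrightarrow> \<bar>s\<bar> powr p) (at_right 0)"
    and "((\<lambda>e. \<bar>s * (s\<^sup>2 + e) powr (p / 2 - 1)\<bar>) \<longlongrightarrow> \<bar>s\<bar> powr (p - 1)) (at_right 0)"
    and "((\<lambda>e. ((s\<^sup>2 + e) powr (p / 2) - e powr (p / 2)) / p) \<longlongrightarrow> \<bar>s\<bar> powr p / p) (at_right 0)"
proof -
  have l: "((\<lambda>e. (s\<^sup>2 + e) powr a) \<longlongrightarrow> (s\<^sup>2) powr a) (at_right 0)" if "s \<noteq> 0" for a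
    using that by (auto intro!: tendsto_eq_intros)
  have sq: "(s\<^sup>2) powr a = \<bar>s\<bar> powr (2 * a)" if "s \<noteq> 0" for a
    using that powr_powr[of "\<bar>s\<bar>" 2 a] by simp
  have e: "\<bar>s\<bar> * \<bar>s\<bar> powr a = \<bar>s\<bar> powr (1 + a)" if "s \<noteq> 0" for a
    using that powr_add[of "\<bar>s\<bar>" 1 a] by simp
  show "((\<lambda>e. \<bar>s * (s\<^sup>2 + e) powr (p / 2 - 1)\<bar>) \<longlongrightarrow> \<bar>s\<bar> powr (p - 1)) (at_right 0)"
  proof (cases "s = 0")
    case False
    then have "((\<lambda>e. \<bar>s\<bar> * (s\<^sup>2 + e) powr (p / 2 - 1)) \<longlongrightarrow> \<bar>s\<bar> * (s\<^sup>2) powr (p / 2 - 1)) (at_right 0)"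
      by (intro tendsto_intros l)
    then show ?thesis using False sq[of "p / 2 - 1"] e[of "p - 2"] by (simp add: abs_mult)
  qed simp
  show "((\<lambda>e. (s * (s\<^sup>2 + e) powr (p / 4 - 1 / 2))\<^sup>2) \<longlongrightarrow> \<bar>s\<bar> powr p) (at_right 0)"
  proof (cases "s = 0")
    case False
    then have "((\<lambda>e. (s * (s\<^sup>2 + e) powr (p / 4 - 1 / 2))\<^sup>2) \<longlongrightarrow> (s * (s\<^sup>2) powr (p / 4 - 1 / 2))\<^sup>2) (at_right 0)"
      by (intro tendsto_intros l)
    moreover have "(s * (s\<^sup>2) powr (p / 4 - 1 / 2))\<^sup>2 = (\<bar>s\<bar> * \<bar>s\<bar> powr (p / 2 - 1))\<^sup>2"
      using False sq[of "p / 4 - 1 / 2"] by (simp add: power_mult_distrib)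
    moreover have "(\<bar>s\<bar> * \<bar>s\<bar> powr (p / 2 - 1))\<^sup>2 = \<bar>s\<bar> powr p"
      unfolding e[OF False] power2_eq_square powr_add[symmetric] by simp
    ultimately show ?thesis by simp
  qed (use assms in simp)
  show "((\<lambda>e. ((s\<^sup>2 + e) powr (p / 2) - e powr (p / 2)) / p) \<longlongrightarrow> \<bar>s\<bar> powr p / p) (at_right 0)"
  proof (cases "s = 0")
    case False
    have "((\<lambda>e::real. e powr (p / 2)) \<longlongrightarrow> 0) (at_right 0)"
      using assms eventually_mono[OF eventually_at_right_less[of "0::real"] less_imp_le]
      by (auto intro!: tendsto_eq_intros)
    then have "((\<lambda>e. ((s\<^sup>2 + e) powr (p / 2) - e powr (p / 2)) / p) \<longlongrightarrow> ((s\<^sup>2) powr (p / 2) - 0) / p) (at_right 0)"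
      using assms False by (intro tendsto_intros l) auto
    then show ?thesis using sq[OF False, of "p / 2"] by simp
  qed (use assms in simp)
qed

text \<open>Dominated convergence on a compact set, in the form in which the regularisation is removed. The
bound is required locally uniformly because \<open>u\<close> is bounded on \<open>K\<close>.\<close>

lemma set_integral_powr_regularisation_tendsto:
  fixes u W :: "'a::euclidean_space \<Rightarrow> real" and F :: "real \<Rightarrow> real \<Rightarrow> real"
  assumes K: "compact K" and W: "continuous_on K W" and u: "continuous_on K u"
    and cont: "\<And>e. e > 0 \<Longrightarrow> continuous_on UNIV (F e)"
    and bound: "\<And>e s M. 0 < e \<Longrightarrow> e \<le> 1 \<Longrightarrow> \<bar>s\<bar> \<le> M \<Longrightarrow> \<bar>F e s\<bar> \<le> B M"
    and lim: "\<And>s. ((\<lambda>e. F e s) \<longlongrightarrow> f s) (at_right 0)"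
  shows "(\<lambda>n. LINT x:K|lborel. W x * F (1 / real (Suc n)) (u x)) \<longlonglongrightarrow> (LINT x:K|lborel. W x * f (u x))"
proof -
  have "bounded (u ` K)" using compact_continuous_image[OF u K] compact_imp_bounded by blast
  then obtain M where M: "\<And>x. x \<in> K \<Longrightarrow> \<bar>u x\<bar> \<le> M" by (auto simp: bounded_iff)
  have "filterlim (\<lambda>n. 1 / real (Suc n)) (at_right 0) sequentially"
    using LIMSEQ_inverse_real_of_nat
    by (auto simp: filterlim_at inverse_eq_divide)
  from filterlim_compose[OF lim this]
  have lim': "(\<lambda>n. F (1 / real (Suc n)) s) \<longlonglongrightarrow> f s" for s .
  have int: "integrable lborel (\<lambda>x. indicator K x *\<^sub>R (W x * F (1 / real (Suc n)) (u x)))" for n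
    by (intro borel_integrable_compact[OF K] continuous_intros W
        continuous_on_compose2[OF cont u]) auto
  have pw: "(\<lambda>n. indicator K x *\<^sub>R (W x * F (1 / real (Suc n)) (u x)))
      \<longlonglongrightarrow> indicator K x *\<^sub>R (W x * f (u x))" for x
    by (intro tendsto_intros lim')
  show ?thesis
    unfolding set_lebesgue_integral_def
  proof (rule integral_dominated_convergence)
    show "(\<lambda>x. indicator K x *\<^sub>R (W x * f (u x))) \<in> borel_measurable lborel"
      by (rule borel_measurable_LIMSEQ_real[OF pw borel_measurable_integrable[OF int]])
    show "integrable lborel (\<lambda>x. indicator K x *\<^sub>R (\<bar>W x\<bar> * B M))"
      by (intro borel_integrable_compact[OF K] continuous_intros W)
    show "AE x in lborel. norm (indicator K x *\<^sub>R (W x * F (1 / real (Suc n)) (u x)))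
        \<le> indicator K x *\<^sub>R (\<bar>W x\<bar> * B M)" for n
    proof (rule AE_I2)
      fix x
      have "\<bar>W x\<bar> * \<bar>F (1 / real (Suc n)) (u x)\<bar> \<le> \<bar>W x\<bar> * B M" if "x \<in> K"
        using M[OF that] by (intro mult_left_mono bound) auto
      then show "norm (indicator K x *\<^sub>R (W x * F (1 / real (Suc n)) (u x)))
        \<le> indicator K x *\<^sub>R (\<bar>W x\<bar> * B M)" by (auto simp: indicator_def abs_mult)
    qed
  qed (use int pw in auto)
qed

text \<open>For the regularised powers, integration by parts gives the energy of \<open>u\<close> weighted by \<open>\<phi>'(u)\<close>, which dominates that
of the odd function \<open>\<psi>(u)\<close>, and \<open>odd_hardy\<close> applies. The limit \<open>e \<rightarrow> 0\<close> then needs no information on the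
zeros of \<open>u\<close>, since no derivative of \<open>u\<close> other than the Laplacian is left.\<close>

lemma odd_rellich_bilinear:
  fixes u :: "real^'n \<Rightarrow> real" and g :: "real^'n \<Rightarrow> real^'n"
  assumes p: "p > 1" and K: "compact K" "0 \<notin> K"
    and deriv: "\<And>x. (u has_derivative (\<lambda>h. g x \<bullet> h)) (at x)"
    and contg: "continuous_on UNIV g"
    and deriv2: "\<And>b x. b \<in> Basis \<Longrightarrow> ((\<lambda>y. g y \<bullet> b) has_derivative H b x) (at x)"
    and contH: "\<And>b. b \<in> Basis \<Longrightarrow> continuous_on UNIV (\<lambda>x. H b x b)"
    and zero: "\<And>x. x \<notin> K \<Longrightarrow> u x = 0" "\<And>x. x \<notin> K \<Longrightarrow> g x = 0"
    and odd: "\<And>x. u (- x) = - u x"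
  shows "(4 * (p - 1) / p\<^sup>2 * (((real CARD('n) - 2 - \<alpha>) / 2)\<^sup>2 + (real CARD('n) - 1))
        + \<alpha> * (real CARD('n) - 2 - \<alpha>) / p) * (LINT x:K|lborel. norm x powr (- \<alpha> - 2) * \<bar>u x\<bar> powr p)
    \<le> (LINT x:K|lborel. norm x powr (- \<alpha>) * \<bar>\<Sum>b\<in>Basis. H b x b\<bar> * \<bar>u x\<bar> powr (p - 1))"
proof -
  define d where "d = real CARD('n)"
  define C where "C = ((d - 2 - \<alpha>) / 2)\<^sup>2 + (d - 1)"
  define c where "c = 4 * (p - 1) / p\<^sup>2"
  define \<Phi> where "\<Phi> e s = ((s\<^sup>2 + e) powr (p / 2) - e powr (p / 2)) / p" for e s :: real
  define \<phi> where "\<phi> e s = s * (s\<^sup>2 + e) powr (p / 2 - 1)" for e s :: real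
  define \<phi>' where "\<phi>' e s = (s\<^sup>2 + e) powr (p / 2 - 2) * ((p - 1) * s\<^sup>2 + e)" for e s :: real
  define \<psi> where "\<psi> e s = s * (s\<^sup>2 + e) powr (p / 4 - 1 / 2)" for e s :: real
  define \<psi>' where "\<psi>' e s = (s\<^sup>2 + e) powr (p / 4 - 3 / 2) * (p / 2 * s\<^sup>2 + e)" for e s :: real
  define L where "L x = (\<Sum>b\<in>Basis. H b x b)" for x
  have c: "c > 0" using p by (simp add: c_def)
  have K0: "x \<noteq> 0" if "x \<in> K" for x using that K by auto
  have contu: "continuous_on A u" for A
    by (intro continuous_at_imp_continuous_on ballI has_derivative_continuous[OF deriv])
  have contg': "continuous_on A g" for A using contg continuous_on_subset by blast
  have contL: "continuous_on A L" for A
    unfolding L_def using contH continuous_on_subset by (intro continuous_intros) blast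
  have d\<Phi>: "(\<Phi> e has_real_derivative \<phi> e s) (at s)"
    and d\<phi>: "(\<phi> e has_real_derivative \<phi>' e s) (at s)"
    and d\<psi>: "(\<psi> e has_real_derivative \<psi>' e s) (at s)"
    and le: "c * (\<psi>' e s)\<^sup>2 \<le> \<phi>' e s" if "e > 0" for e s
    using regularised_power_derivs[OF that p, of s]
    unfolding \<Phi>_def[abs_def] \<phi>_def[abs_def] \<phi>'_def \<psi>_def[abs_def] \<psi>'_def c_def by simp_all
  have pos: "s\<^sup>2 + e > 0" if "e > 0" for e s :: real using that by (simp add: add_nonneg_pos)
  have cont': "continuous_on UNIV (\<phi>' e)" "continuous_on UNIV (\<psi>' e)"
    "continuous_on UNIV (\<lambda>s. (\<psi> e s)\<^sup>2)" "continuous_on UNIV (\<lambda>s. \<bar>\<phi> e s\<bar>)" "continuous_on UNIV (\<Phi> e)"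
    if "e > 0" for e
    unfolding \<phi>'_def[abs_def] \<psi>'_def[abs_def] \<psi>_def \<phi>_def \<Phi>_def[abs_def]
    using p by (auto intro!: continuous_intros simp: less_imp_neq[OF pos[OF that], symmetric])
  have reg: "c * C * (LINT x:K|lborel. norm x powr (- \<alpha> - 2) * (\<psi> e (u x))\<^sup>2)
      + \<alpha> * (d - 2 - \<alpha>) * (LINT x:K|lborel. norm x powr (- \<alpha> - 2) * \<Phi> e (u x))
      \<le> (LINT x:K|lborel. norm x powr (- \<alpha>) * \<bar>L x\<bar> * \<bar>\<phi> e (u x)\<bar>)" if e: "e > 0" for e
  proof -
    have cp: "continuous_on A (\<lambda>x. \<psi>' e (u x))" "continuous_on A (\<lambda>x. \<phi>' e (u x))" for A
      by (rule continuous_on_compose2[OF cont'(2)[OF e] contu] continuous_on_compose2[OF cont'(1)[OF e] contu]; simp)+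
    have cphi: "continuous_on A (\<lambda>x. \<phi> e (u x))" for A
      by (rule continuous_on_compose2[OF _ contu, of UNIV])
        (auto intro: continuous_at_imp_continuous_on DERIV_isCont d\<phi>[OF e])
    have "C * (LINT x:K|lborel. norm x powr (- \<alpha> - 2) * (\<psi> e (u x))\<^sup>2)
      \<le> (LINT x:K|lborel. norm x powr (- \<alpha>) * (norm (\<psi>' e (u x) *\<^sub>R g x))\<^sup>2)"
      unfolding C_def d_def
    proof (rule odd_hardy[OF K])
      show "((\<lambda>x. \<psi> e (u x)) has_derivative (\<lambda>h. (\<psi>' e (u x) *\<^sub>R g x) \<bullet> h)) (at x)" for x
        using diff_chain_at[OF deriv d\<psi>[OF e, unfolded has_field_derivative_def]] by (simp add: o_def)
      show "continuous_on UNIV (\<lambda>x. \<psi>' e (u x) *\<^sub>R g x)"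
        by (intro continuous_intros cp contg')
    qed (simp_all add: \<psi>_def zero odd)
    then have "c * (C * (LINT x:K|lborel. norm x powr (- \<alpha> - 2) * (\<psi> e (u x))\<^sup>2))
      \<le> c * (LINT x:K|lborel. norm x powr (- \<alpha>) * (norm (\<psi>' e (u x) *\<^sub>R g x))\<^sup>2)"
      using c by (intro mult_left_mono) auto
    also have "\<dots> = (LINT x:K|lborel. norm x powr (- \<alpha>) * (c * (\<psi>' e (u x))\<^sup>2 * (norm (g x))\<^sup>2))"
      by (subst set_integral_mult_right[symmetric]) (simp add: power_mult_distrib ac_simps)
    also have "\<dots> \<le> (LINT x:K|lborel. norm x powr (- \<alpha>) * (\<phi>' e (u x) * (norm (g x))\<^sup>2))"
      by (intro set_integral_mono set_integrable_continuous_compact[OF K(1)] continuous_intros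
          cp contg' K0 mult_left_mono mult_right_mono le[OF e]) auto
    also have "\<dots> = - (LINT x:K|lborel. norm x powr (- \<alpha>) * (\<phi> e (u x) * L x))
        - \<alpha> * (d - 2 - \<alpha>) * (LINT x:K|lborel. norm x powr (- \<alpha> - 2) * \<Phi> e (u x))"
      using integral_laplacian_by_parts[OF K deriv contg deriv2 contH zero d\<Phi>[OF e] _ d\<phi>[OF e] cont'(1)[OF e], of \<alpha>]
      by (simp add: L_def d_def \<Phi>_def)
    also have "- (LINT x:K|lborel. norm x powr (- \<alpha>) * (\<phi> e (u x) * L x))
       \<le> (LINT x:K|lborel. norm x powr (- \<alpha>) * \<bar>L x\<bar> * \<bar>\<phi> e (u x)\<bar>)"
    proof -
      have "- (LINT x:K|lborel. norm x powr (- \<alpha>) * (\<phi> e (u x) * L x))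
        = (LINT x:K|lborel. - (norm x powr (- \<alpha>) * (\<phi> e (u x) * L x)))"
        by (simp add: set_lebesgue_integral_def)
      also have "\<dots> \<le> (LINT x:K|lborel. norm x powr (- \<alpha>) * \<bar>L x\<bar> * \<bar>\<phi> e (u x)\<bar>)"
      proof (intro set_integral_mono set_integrable_continuous_compact[OF K(1)] continuous_intros cphi contL K0)
        fix x
        have "norm x powr (- \<alpha>) * - (\<phi> e (u x) * L x) \<le> norm x powr (- \<alpha>) * (\<bar>L x\<bar> * \<bar>\<phi> e (u x)\<bar>)"
          by (intro mult_left_mono) (auto simp: abs_mult[symmetric] mult.commute intro: abs_le_D2)
        then show "- (norm x powr (- \<alpha>) * (\<phi> e (u x) * L x)) \<le> norm x powr (- \<alpha>) * \<bar>L x\<bar> * \<bar>\<phi> e (u x)\<bar>"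
          by (simp add: mult.assoc)
      qed (use K in auto)
      finally show ?thesis .
    qed
    finally show ?thesis by (simp add: mult.assoc)
  qed
  have cW: "continuous_on K (\<lambda>x. norm x powr a)" for a
    by (intro continuous_intros K0)
  have l1: "(\<lambda>n. LINT x:K|lborel. norm x powr (- \<alpha> - 2) * (\<psi> (1 / real (Suc n)) (u x))\<^sup>2)
      \<longlonglongrightarrow> (LINT x:K|lborel. norm x powr (- \<alpha> - 2) * \<bar>u x\<bar> powr p)"
    by (rule set_integral_powr_regularisation_tendsto[where F = "\<lambda>e s. (\<psi> e s)\<^sup>2", OF K(1) cW contu cont'(3)])
      (use regularised_power_bounds(1)[OF p] regularised_power_tendsto(1)[OF p] in \<open>auto simp: \<psi>_def\<close>)
  have l2: "(\<lambda>n. LINT x:K|lborel. norm x powr (- \<alpha> - 2) * \<Phi> (1 / real (Suc n)) (u x))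
      \<longlonglongrightarrow> (LINT x:K|lborel. norm x powr (- \<alpha> - 2) * (\<bar>u x\<bar> powr p / p))"
    by (rule set_integral_powr_regularisation_tendsto[where F = \<Phi>, OF K(1) cW contu cont'(5)])
      (use regularised_power_bounds(3)[OF p] regularised_power_tendsto(3)[OF p] in \<open>auto simp: \<Phi>_def\<close>)
  have l3: "(\<lambda>n. LINT x:K|lborel. norm x powr (- \<alpha>) * \<bar>L x\<bar> * \<bar>\<phi> (1 / real (Suc n)) (u x)\<bar>)
      \<longlonglongrightarrow> (LINT x:K|lborel. norm x powr (- \<alpha>) * \<bar>L x\<bar> * \<bar>u x\<bar> powr (p - 1))"
    by (rule set_integral_powr_regularisation_tendsto[where F = "\<lambda>e s. \<bar>\<phi> e s\<bar>", OF K(1) _ contu cont'(4)])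
      (use regularised_power_bounds(2)[OF p] regularised_power_tendsto(2)[OF p] in
        \<open>auto simp: \<phi>_def intro!: continuous_intros cW contL\<close>)
  have "c * C * (LINT x:K|lborel. norm x powr (- \<alpha> - 2) * \<bar>u x\<bar> powr p)
      + \<alpha> * (d - 2 - \<alpha>) * (LINT x:K|lborel. norm x powr (- \<alpha> - 2) * (\<bar>u x\<bar> powr p / p))
      \<le> (LINT x:K|lborel. norm x powr (- \<alpha>) * \<bar>L x\<bar> * \<bar>u x\<bar> powr (p - 1))"
    by (rule LIMSEQ_le[OF tendsto_add[OF tendsto_mult_left[OF l1] tendsto_mult_left[OF l2]] l3])
      (use reg in auto)
  moreover have "(LINT x:K|lborel. norm x powr (- \<alpha> - 2) * (\<bar>u x\<bar> powr p / p))
    = (LINT x:K|lborel. norm x powr (- \<alpha> - 2) * \<bar>u x\<bar> powr p) / p"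
    by (simp only: times_divide_eq_right set_integral_divide_zero)
  ultimately show ?thesis
    unfolding L_def C_def c_def d_def by (simp add: algebra_simps)
qed

section \<open>Rellich's inequality for odd functions\<close>

text \<open>Young's inequality for \<open>a\<close> and \<open>c powr (p - 1)\<close>; unlike convexity on \<open>{0<..}\<close> it covers \<open>a = 0\<close> and \<open>c = 0\<close>.\<close>

lemma powr_above_tangent:
  fixes a c p :: real
  assumes "p > 1" "a \<ge> 0" "c \<ge> 0"
  shows "c powr p + p * c powr (p - 1) * (a - c) \<le> a powr p"
proof -
  define q where "q = p / (p - 1)"
  have "a * c powr (p - 1) \<le> a powr p / p + (c powr (p - 1)) powr q / q"
    using assms by (intro Youngs_inequality) (auto simp: q_def field_simps)
  also have "(c powr (p - 1)) powr q = c powr p"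
    using assms by (simp add: powr_powr q_def)
  finally have "p * (a * c powr (p - 1)) \<le> p * (a powr p / p + c powr p / q)"
    using assms by (intro mult_left_mono) auto
  also have "\<dots> = a powr p + (p - 1) * c powr p"
    using assms by (simp add: q_def field_simps)
  finally have "p * (a * c powr (p - 1)) \<le> a powr p + (p - 1) * c powr p" .
  moreover have "c powr (p - 1) * c = c powr p"
    using assms powr_add[of c "p - 1" 1] by (cases "c = 0") auto
  ultimately show ?thesis by (simp add: algebra_simps)
qed

theorem theorem7:
  fixes p \<gamma> :: real and u :: "real ^ 'n \<Rightarrow> real"
  assumes "p > 1"
    and "u \<in> C2c (- {0})"
    and "odd_fun u"
    and "rellich_N CARD('n) p \<gamma> \<ge> 0"
  shows "(LINT x|lborel. \<bar>laplacian u x\<bar> powr p / norm x powr \<gamma>)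
    \<ge> D_R CARD('n) p \<gamma> * (LINT x|lborel. \<bar>u x\<bar> powr p / norm x powr (\<gamma> + 2 * p))"
proof -
  note p = \<open>p > 1\<close>
  obtain K g H where K: "compact K" "0 \<notin> K"
    and deriv: "\<And>x. (u has_derivative (\<lambda>h. g x \<bullet> h)) (at x)" and contg: "continuous_on UNIV g"
    and deriv2: "\<And>b x. b \<in> Basis \<Longrightarrow> ((\<lambda>y. g y \<bullet> b) has_derivative H b x) (at x)"
    and contH: "\<And>b. b \<in> Basis \<Longrightarrow> continuous_on UNIV (\<lambda>x. H b x b)"
    and lap: "\<And>x. laplacian u x = (\<Sum>b\<in>Basis. H b x b)"
    and zero: "\<And>x. x \<notin> K \<Longrightarrow> u x = 0" "\<And>x. x \<notin> K \<Longrightarrow> g x = 0"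
    and lap0: "\<And>x. x \<notin> K \<Longrightarrow> laplacian u x = 0"
    using C2c_gradient[OF \<open>u \<in> C2c (- {0})\<close>] by blast
  have odd: "u (- x) = - u x" for x using \<open>odd_fun u\<close> by (simp add: odd_fun_def)
  have K0: "x \<noteq> 0" if "x \<in> K" for x using that K by auto
  have contu: "continuous_on A u" for A
    by (intro continuous_at_imp_continuous_on ballI has_derivative_continuous[OF deriv])
  have contL: "continuous_on A (laplacian u)" for A
    unfolding lap using contH continuous_on_subset by (intro continuous_intros) blast
  define d where "d = real CARD('n)"
  define \<alpha> where "\<alpha> = \<gamma> + 2 * p - 2"
  define B where "B = rellich_N CARD('n) p \<gamma> / p\<^sup>2"
  have "B \<ge> 0" using assms by (simp add: B_def)
  have "4 * (p - 1) / p\<^sup>2 * (((d - 2 - \<alpha>) / 2)\<^sup>2 + (d - 1)) + \<alpha> * (d - 2 - \<alpha>) / p = B"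
  proof -
    have "4 * (p - 1) * (((d - 2 - \<alpha>) / 2)\<^sup>2 + (d - 1)) + p * (\<alpha> * (d - 2 - \<alpha>)) = rellich_N CARD('n) p \<gamma>"
      by (simp add: rellich_N_def d_def[symmetric] \<alpha>_def power2_eq_square field_simps)
    then have "B = (4 * (p - 1) * (((d - 2 - \<alpha>) / 2)\<^sup>2 + (d - 1)) + p * (\<alpha> * (d - 2 - \<alpha>))) / p\<^sup>2"
      by (simp only: B_def)
    also have "\<dots> = 4 * (p - 1) * (((d - 2 - \<alpha>) / 2)\<^sup>2 + (d - 1)) / p\<^sup>2 + p * (\<alpha> * (d - 2 - \<alpha>)) / p\<^sup>2"
      by (rule add_divide_distrib)
    finally show ?thesis using p by (simp add: power2_eq_square)
  qed
  with odd_rellich_bilinear[OF p K deriv contg deriv2 contH zero odd, of \<alpha>]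
  have bil: "B * (LINT x:K|lborel. norm x powr (- \<alpha> - 2) * \<bar>u x\<bar> powr p)
    \<le> (LINT x:K|lborel. norm x powr (- \<alpha>) * \<bar>laplacian u x\<bar> * \<bar>u x\<bar> powr (p - 1))"
    by (simp add: d_def lap)
  define I where "I = (LINT x:K|lborel. norm x powr (- \<alpha> - 2) * \<bar>u x\<bar> powr p)"
  define J where "J = (LINT x:K|lborel. norm x powr (- \<alpha>) * \<bar>laplacian u x\<bar> * \<bar>u x\<bar> powr (p - 1))"
  have cpow: "continuous_on K (\<lambda>x. \<bar>f x\<bar> powr a)" if "continuous_on K f" "a > 0" for f :: "real^'n \<Rightarrow> real" and a
    using that by (intro continuous_on_powr' continuous_intros) auto
  have i1: "set_integrable lborel K (\<lambda>x. B powr p * (norm x powr (- \<alpha> - 2) * \<bar>u x\<bar> powr p))"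
    and i2: "set_integrable lborel K (\<lambda>x. p * B powr (p - 1) *
        (norm x powr (- \<alpha>) * \<bar>laplacian u x\<bar> * \<bar>u x\<bar> powr (p - 1)))"
    and i3: "set_integrable lborel K (\<lambda>x. p * B powr (p - 1) * (B * (norm x powr (- \<alpha> - 2) * \<bar>u x\<bar> powr p)))"
    and i4: "set_integrable lborel K (\<lambda>x. norm x powr (- \<gamma>) * \<bar>laplacian u x\<bar> powr p)"
    using p by (intro set_integrable_continuous_compact[OF K(1)] continuous_intros cpow contu contL K0; simp)+
  \<comment> \<open>The added term is nonnegative by \<open>bil\<close>; under the integral it is the linear part of the tangent at \<open>B * b\<close> below.\<close>
  have "B powr p * I \<le> B powr p * I + (p * B powr (p - 1) * J - p * B powr (p - 1) * (B * I))"
    using bil p unfolding I_def[symmetric] J_def[symmetric]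
    by (simp add: mult_left_mono)
  also have "\<dots> = (LINT x:K|lborel. B powr p * (norm x powr (- \<alpha> - 2) * \<bar>u x\<bar> powr p)
      + (p * B powr (p - 1) * (norm x powr (- \<alpha>) * \<bar>laplacian u x\<bar> * \<bar>u x\<bar> powr (p - 1))
      - p * B powr (p - 1) * (B * (norm x powr (- \<alpha> - 2) * \<bar>u x\<bar> powr p))))"
    unfolding I_def J_def
    by (simp only: set_integral_add(2)[OF i1 set_integral_diff(1)[OF i2 i3]]
        set_integral_diff(2)[OF i2 i3] set_integral_mult_right)
  also have "\<dots> \<le> (LINT x:K|lborel. norm x powr (- \<gamma>) * \<bar>laplacian u x\<bar> powr p)"
  proof (rule set_integral_mono[OF set_integral_add(1)[OF i1 set_integral_diff(1)[OF i2 i3]] i4])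
    fix x assume "x \<in> K"
    then have r: "norm x > 0" using K0 by simp
    \<comment> \<open>The powers of \<open>\<bar>x\<bar>\<close> are distributed such that \<open>a powr p\<close>, \<open>b powr p\<close> and \<open>a * b powr (p - 1)\<close> are the three integrands.\<close>
    define a where "a = \<bar>laplacian u x\<bar> * norm x powr (- \<gamma> / p)"
    define b where "b = \<bar>u x\<bar> * norm x powr ((- \<alpha> - 2) / p)"
    have ab: "a \<ge> 0" "b \<ge> 0" by (simp_all add: a_def b_def)
    have "a powr p = norm x powr (- \<gamma>) * \<bar>laplacian u x\<bar> powr p"
      using p by (simp add: a_def powr_mult powr_powr)
    moreover have bp: "b powr p = norm x powr (- \<alpha> - 2) * \<bar>u x\<bar> powr p"
      using p by (simp add: b_def powr_mult powr_powr)
    moreover have "a * b powr (p - 1) = norm x powr (- \<alpha>) * \<bar>laplacian u x\<bar> * \<bar>u x\<bar> powr (p - 1)"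
    proof -
      have "- \<gamma> / p + (- \<alpha> - 2) / p * (p - 1) = - \<alpha>"
        using p by (simp add: \<alpha>_def field_simps)
      then have "norm x powr (- \<gamma> / p) * norm x powr ((- \<alpha> - 2) / p * (p - 1)) = norm x powr (- \<alpha>)"
        by (simp only: powr_add[symmetric])
      then show ?thesis
        unfolding a_def b_def by (simp add: powr_mult powr_powr)
    qed
    moreover have "b powr (p - 1) * b = b powr p"
      using ab p powr_add[of b "p - 1" 1] by (cases "b = 0") auto
    moreover have "(B * b) powr p + p * (B * b) powr (p - 1) * (a - B * b) \<le> a powr p"
      using powr_above_tangent[OF p, of a "B * b"] ab \<open>B \<ge> 0\<close> by simp
    moreover have "(B * b) powr p + p * (B * b) powr (p - 1) * (a - B * b)
      = B powr p * b powr p + (p * B powr (p - 1) * (a * b powr (p - 1)) - p * B powr (p - 1) * (B * (b powr (p - 1) * b)))"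
      using ab \<open>B \<ge> 0\<close> by (simp add: powr_mult algebra_simps)
    ultimately show "B powr p * (norm x powr (- \<alpha> - 2) * \<bar>u x\<bar> powr p)
      + (p * B powr (p - 1) * (norm x powr (- \<alpha>) * \<bar>laplacian u x\<bar> * \<bar>u x\<bar> powr (p - 1))
      - p * B powr (p - 1) * (B * (norm x powr (- \<alpha> - 2) * \<bar>u x\<bar> powr p)))
      \<le> norm x powr (- \<gamma>) * \<bar>laplacian u x\<bar> powr p"
      by (simp only:)
  qed
  finally have main: "B powr p * I \<le> (LINT x:K|lborel. norm x powr (- \<gamma>) * \<bar>laplacian u x\<bar> powr p)" .
  have "(LINT x|lborel. \<bar>laplacian u x\<bar> powr p / norm x powr \<gamma>)
    = (LINT x:K|lborel. norm x powr (- \<gamma>) * \<bar>laplacian u x\<bar> powr p)"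
    unfolding set_lebesgue_integral_def using lap0 p
    by (intro Bochner_Integration.integral_cong) (auto simp: indicator_def powr_minus_divide)
  moreover have "(LINT x|lborel. \<bar>u x\<bar> powr p / norm x powr (\<gamma> + 2 * p)) = I"
  proof -
    have "- \<alpha> - 2 = - (\<gamma> + 2 * p)" by (simp add: \<alpha>_def)
    then show ?thesis
      unfolding I_def set_lebesgue_integral_def using zero(1) p
      by (intro Bochner_Integration.integral_cong) (auto simp: indicator_def powr_minus_divide simp del: minus_add_distrib)
  qed
  ultimately show ?thesis using main by (simp add: D_R_def B_def)
qed

end
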